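(* Let $\phi$ be a pair of rational functions in $\mathbb{R}(x,y)$ satisfying $$(1-z)\,\phi(\mathbf{x})=\phi\Big(\phi(\mathbf{x}z)\,\frac{1-z}{z}\Big),\qquad\mathbf{x}=(x,y),$$ and not satisfying the condition $\lim_{z\to0}\phi(\mathbf{x}z)/z=\mathbf{x}$. Then either $\phi(\mathbf{x})=\mathbf{0}$ identically, or $\phi$ is of the form $$\phi(x,y)=\Big(A\,\frac{R(x,y)}{cR(x,y)+1},\ B\,\frac{R(x,y)}{cR(x,y)+1}\Big),$$ where $R(x,y)\in\mathbb{R}(x,y)$ is a $1$-homogeneous rational function, and $A,B,c$ are real numbers satisfying $R(A,B)=1$.
   Context: The functional equation is understood as an identity of pairs of rational functions in $x,y,z$ over $\mathbb{R}$ (in particular the composition on the right is assumed to be a well-defined rational function). $1$-homogeneous means homogeneous of degree $1$. *)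

theory Defs
  imports Complex_Main "HOL-Computational_Algebra.Computational_Algebra"
    "HOL-Computational_Algebra.Field_as_Ring"
begin

text \<open>
  The fields \<open>\<real>(x,y)\<close> and \<open>\<real>(x,y,z)\<close>. The variable \<open>x\<close> belongs to the innermost
  polynomial layer, the last variable to the outermost one.
\<close>

type_synonym ratfun2 = "real poly poly fract"
type_synonym ratfun3 = "real poly poly poly fract"

definition const2 :: "real \<Rightarrow> ratfun2" where
  "const2 a = Fract [:[:a:]:] 1"

definition const3 :: "real \<Rightarrow> ratfun3" where
  "const3 a = Fract [:[:[:a:]:]:] 1"

definition X3 :: ratfun3 where "X3 = Fract [:[:[:0, 1:]:]:] 1"
definition Y3 :: ratfun3 where "Y3 = Fract [:[:0, 1:]:] 1"
definition Z3 :: ratfun3 where "Z3 = Fract [:0, 1:] 1"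

definition poly2 :: "(real \<Rightarrow> 'k) \<Rightarrow> real poly poly \<Rightarrow> 'k \<Rightarrow> 'k \<Rightarrow> 'k::field" where
  "poly2 h p u v = poly (map_poly (\<lambda>q. poly (map_poly h q) u) p) v"

text \<open>
  Substitution of \<open>(u, v)\<close> for \<open>(x, y)\<close> in a rational function, with values in a field
  extension \<open>h\<close> of the reals. Since \<^const>\<open>quot_of_fract\<close> yields the coprime
  representation, whose denominator divides every other one, the substitution is defined
  iff some representation \<open>p / q\<close> satisfies \<open>q(u, v) \<noteq> 0\<close>.
\<close>

definition ratfun_defined_at :: "(real \<Rightarrow> 'k) \<Rightarrow> ratfun2 \<Rightarrow> 'k \<Rightarrow> 'k::field \<Rightarrow> bool" where
  "ratfun_defined_at h f u v \<longleftrightarrow> poly2 h (snd (quot_of_fract f)) u v \<noteq> 0"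

definition ratfun_eval :: "(real \<Rightarrow> 'k) \<Rightarrow> ratfun2 \<Rightarrow> 'k \<Rightarrow> 'k \<Rightarrow> 'k::field" where
  "ratfun_eval h f u v =
     poly2 h (fst (quot_of_fract f)) u v / poly2 h (snd (quot_of_fract f)) u v"

definition pair_eval ::
    "(real \<Rightarrow> 'k) \<Rightarrow> ratfun2 \<times> ratfun2 \<Rightarrow> 'k \<times> 'k \<Rightarrow> 'k::field \<times> 'k" where
  "pair_eval h \<phi> w =
     (ratfun_eval h (fst \<phi>) (fst w) (snd w), ratfun_eval h (snd \<phi>) (fst w) (snd w))"

definition pair_defined_at ::
    "(real \<Rightarrow> 'k) \<Rightarrow> ratfun2 \<times> ratfun2 \<Rightarrow> 'k \<times> 'k::field \<Rightarrow> bool" where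
  "pair_defined_at h \<phi> w \<longleftrightarrow>
     ratfun_defined_at h (fst \<phi>) (fst w) (snd w) \<and> ratfun_defined_at h (snd \<phi>) (fst w) (snd w)"

definition scale_pair :: "'k \<Rightarrow> 'k \<times> 'k \<Rightarrow> 'k::times \<times> 'k" where
  "scale_pair c w = (c * fst w, c * snd w)"

text \<open>
  The inner substitutions need no definedness condition: \<open>x, y\<close>, and likewise
  \<open>xz, yz\<close>, are algebraically independent over \<open>\<real>\<close>, so no denominator vanishes.
\<close>

definition translation_equation :: "ratfun2 \<times> ratfun2 \<Rightarrow> bool" where
  "translation_equation \<phi> \<longleftrightarrow>
     (let w = scale_pair ((1 - Z3) / Z3) (pair_eval const3 \<phi> (X3 * Z3, Y3 * Z3))
      in pair_defined_at const3 \<phi> w \<and>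
         scale_pair (1 - Z3) (pair_eval const3 \<phi> (X3, Y3)) = pair_eval const3 \<phi> w)"

text \<open>
  \<open>\<phi>(xz) / z \<rightarrow> x\<close> as \<open>z \<rightarrow> 0\<close>, for generic real \<open>(x, y)\<close>, i.e. outside the zero set of some
  nonzero polynomial; a rational \<open>\<phi>\<close> with the limit property may fail it on such a set.
  For generic \<open>(a, b)\<close> the denominators do not vanish at \<open>(a z, b z)\<close> for small \<open>z \<noteq> 0\<close>,
  so division by zero plays no role.
\<close>

definition limit_condition :: "ratfun2 \<times> ratfun2 \<Rightarrow> bool" where
  "limit_condition \<phi> \<longleftrightarrow>
     (\<exists>d :: real poly poly. d \<noteq> 0 \<and>
        (\<forall>a b. poly2 (\<lambda>t. t) d a b \<noteq> 0 \<longrightarrow>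
           ((\<lambda>z. scale_pair (1 / z) (pair_eval (\<lambda>t. t) \<phi> (a * z, b * z))) \<longlongrightarrow> (a, b)) (at 0)))"

definition one_homogeneous :: "ratfun2 \<Rightarrow> bool" where
  "one_homogeneous R \<longleftrightarrow>
     ratfun_eval const3 R (X3 * Z3) (Y3 * Z3) = Z3 * ratfun_eval const3 R X3 Y3"

end

theory Submission
  imports Defs
begin

text \<open>
  Write \<open>\<phi> = (u, v)\<close>. Letting \<open>z \<rightarrow> 1\<close> in the equation sends the argument \<open>\<phi>(xz) (1 - z) / z\<close> of
  the outer \<open>\<phi>\<close> to the origin in the direction of \<open>\<phi>(x)\<close>, while the left-hand side vanishes to
  first order. Comparing lowest homogeneous components of numerators and denominators, each
  component of \<open>\<phi>\<close> either has the limit required by the limit condition, or some nonzero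
  homogeneous polynomial vanishes at \<open>\<phi>(x)\<close> for generic \<open>x\<close> (\<open>component_dichotomy\<close>). The zeros of
  such a polynomial lie on finitely many lines through the origin, so in the second case \<open>u\<close> and
  \<open>v\<close> are proportional and \<open>\<phi> = (A f, B f)\<close> with \<open>f = u\<close>, \<open>A = 1\<close> or \<open>f = v\<close>, \<open>B = 1\<close>
  (\<open>translation_equation_line\<close>).

  For nonzero \<open>f\<close> the equation becomes scalar: \<open>(1 - z) f(x) = g(f(xz) (1 - z) / z)\<close> with
  \<open>g(\<tau>) = f(A \<tau>, B \<tau>)\<close>. Again \<open>z \<rightarrow> 1\<close> gives \<open>g(\<tau>) = \<tau> - C \<tau>\<^sup>2 + \<dots>\<close>, and the derivative
  at \<open>z = 1\<close> gives \<open>E f = f - C f\<^sup>2\<close> for the Euler derivative \<open>E\<close>. It says that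
  \<open>1 / f - C\<close> is homogeneous of degree \<open>-1\<close>, so \<open>R = f / (1 - C f)\<close> is homogeneous of degree one
  (\<open>scalar_flow_homogeneity\<close>) and \<open>f = R / (C R + 1)\<close>. Finally \<open>R(A \<tau>, B \<tau>) = R(A, B) \<tau>\<close>, and
  \<open>g\<close> having derivative \<open>1\<close> at \<open>0\<close> forces \<open>R(A, B) = 1\<close> (\<open>linear_fractional_solution\<close>).

  Limits and derivatives are taken at real points. The identities of rational functions pass to real
  values through \<open>translation_equation_real\<close>, and the polynomial identities obtained in this way
  pass back because a polynomial that vanishes at generic real points is zero.
\<close>

section \<open>Evaluation of polynomials\<close>

text \<open>
  Evaluations are ring homomorphisms between types that carry no common carrier set, so a
  predicate on functions serves better here than a homomorphism between explicit structures.
\<close>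

definition rhom :: "('a::comm_ring_1 \<Rightarrow> 'b::comm_ring_1) \<Rightarrow> bool" where
  "rhom h \<longleftrightarrow> h 0 = 0 \<and> h 1 = 1 \<and> (\<forall>x y. h (x + y) = h x + h y) \<and> (\<forall>x y. h (x * y) = h x * h y)"

lemma rhomD:
  assumes "rhom h"
  shows "h 0 = 0" "h 1 = 1" "h (x + y) = h x + h y" "h (x * y) = h x * h y"
    "h (- x) = - h x" "h (x - y) = h x - h y" "h (x ^ n) = h x ^ n"
proof -
  show *: "h 0 = 0" "h 1 = 1" and add: "h (x + y) = h x + h y"
    and mult: "h (x * y) = h x * h y" for x y
    using assms by (auto simp: rhom_def)
  show neg: "h (- x) = - h x" for x
    using add[of x "- x"] * by (simp add: eq_neg_iff_add_eq_0 add.commute)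
  show "h (x - y) = h x - h y" using add[of x "- y"] neg[of y] by simp
  show "h (x ^ n) = h x ^ n" by (induction n) (use * mult in auto)
qed

lemma rhom_eval:
  assumes "rhom h" shows "rhom (\<lambda>p. poly (map_poly h p) u)"
proof -
  note h = rhomD[OF assms]
  have add: "map_poly h (p + q) = map_poly h p + map_poly h q" for p q
    by (rule poly_eqI) (simp add: coeff_map_poly h)
  have smult: "map_poly h (smult a p) = smult (h a) (map_poly h p)" for a p
    by (rule poly_eqI) (simp add: coeff_map_poly h)
  have pCons: "map_poly h (pCons a p) = pCons (h a) (map_poly h p)" for a p
    by (simp add: map_poly_pCons h)
  have mult: "map_poly h (p * q) = map_poly h p * map_poly h q" for p q
    by (induction p) (simp_all add: add smult pCons h)
  show ?thesis
    by (simp add: rhom_def add mult h map_poly_1)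
qed

text \<open>
  This identity moves evaluations past substitutions: a polynomial identity between substituted
  polynomials is checked by applying a real evaluation to both sides.
\<close>

lemma rhom_comm_eval:
  assumes "rhom e" "h 0 = 0"
  shows "e (poly (map_poly h p) u) = poly (map_poly (\<lambda>x. e (h x)) p) (e u)"
  by (induction p) (simp_all add: map_poly_pCons rhomD[OF assms(1)] assms(2))

lemma rhom_id: "rhom (\<lambda>x. x)" by (simp add: rhom_def)

text \<open>
  The substitution \<^const>\<open>poly2\<close>, available in every commutative ring, so that polynomials can
  also be substituted into polynomials.
\<close>

definition subst2 :: "(real \<Rightarrow> 'k) \<Rightarrow> real poly poly \<Rightarrow> 'k \<Rightarrow> 'k \<Rightarrow> 'k::comm_ring_1" where
  "subst2 h p u v = poly (map_poly (\<lambda>q. poly (map_poly h q) u) p) v"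

lemma poly2_eq_subst2: "poly2 h p u v = subst2 h p u v"
  by (simp add: poly2_def subst2_def)

lemma rhom_subst2: "rhom h \<Longrightarrow> rhom (\<lambda>p. subst2 h p u v)"
  unfolding subst2_def by (intro rhom_eval)

lemma rhom_comm_subst2:
  assumes "rhom e" "h 0 = 0"
  shows "e (subst2 h p u v) = subst2 (\<lambda>x. e (h x)) p (e u) (e v)"
proof -
  have inner: "e (poly (map_poly h q) u) = poly (map_poly (\<lambda>x. e (h x)) q) (e u)" for q
    by (rule rhom_comm_eval) (use assms in auto)
  show ?thesis
    unfolding subst2_def
    by (subst rhom_comm_eval[where e = e]) (simp_all add: inner assms)
qed

abbreviation ev2 :: "real poly poly \<Rightarrow> real \<Rightarrow> real \<Rightarrow> real" where
  "ev2 \<equiv> subst2 (\<lambda>t. t)"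

lemma rhom_ev2: "rhom (\<lambda>p. ev2 p a b)" by (intro rhom_subst2 rhom_id)
lemmas ev2_simps [simp] = rhomD[OF rhom_ev2]

definition ev3 :: "real poly poly poly \<Rightarrow> real \<Rightarrow> real \<Rightarrow> real \<Rightarrow> real" where
  "ev3 p a b c = poly (map_poly (\<lambda>q. ev2 q a b) p) c"

lemma rhom_ev3: "rhom (\<lambda>p. ev3 p a b c)"
  unfolding ev3_def by (intro rhom_eval rhom_ev2)
lemmas ev3_simps [simp] = rhomD[OF rhom_ev3]

lemma ev2_pCons: "ev2 (pCons q p) a b = poly q a + b * ev2 p a b"
  by (simp add: subst2_def map_poly_pCons map_poly_idI)
lemma ev3_pCons: "ev3 (pCons q p) a b c = ev2 q a b + c * ev3 p a b c"
  by (simp add: ev3_def map_poly_pCons)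

lemma ev2_smult: "ev2 (smult s p) a b = poly s a * ev2 p a b"
  using ev2_simps(4)[of "[:s:]" p a b] by (simp add: ev2_pCons)

lemma poly_zero_if_vanishes:
  fixes p :: "real poly" assumes "\<And>x. poly p x = 0" shows "p = 0"
  using assms poly_all_0_iff_0 by blast

lemma ev2_zero_if_vanishes:
  assumes "\<And>a b. ev2 p a b = 0" shows "p = 0"
proof (rule poly_eqI)
  fix n
  have "coeff (map_poly (\<lambda>q. poly q a) p) n = 0" for a
    using poly_zero_if_vanishes[of "map_poly (\<lambda>q. poly q a) p"] assms[of a]
    by (simp add: subst2_def map_poly_idI)
  then show "coeff p n = coeff 0 n"
    using poly_zero_if_vanishes[of "coeff p n"] by (simp add: coeff_map_poly)
qed

lemma ev3_zero_if_vanishes: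
  assumes "\<And>a b c. ev3 p a b c = 0" shows "p = 0"
proof (rule poly_eqI)
  fix n
  have "coeff (map_poly (\<lambda>q. ev2 q a b) p) n = 0" for a b
    using poly_zero_if_vanishes[of "map_poly (\<lambda>q. ev2 q a b) p"] assms[of a b]
    by (simp add: ev3_def)
  then show "coeff p n = coeff 0 n"
    using ev2_zero_if_vanishes[of "coeff p n"] by (simp add: coeff_map_poly)
qed

text \<open>
  A nonzero polynomial vanishes almost nowhere, so identities may be tested at generic real points,
  and the exceptional points where denominators vanish can be discarded.
\<close>

lemma ev2_generic_zero:
  assumes "d \<noteq> 0" "\<And>a b. ev2 d a b \<noteq> 0 \<Longrightarrow> ev2 p a b = 0" shows "p = 0"
proof -
  have "ev2 (d * p) a b = 0" for a b using assms(2)[of a b] by auto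
  then have "d * p = 0" by (rule ev2_zero_if_vanishes)
  then show ?thesis using assms(1) by simp
qed

lemma ev3_generic_zero:
  assumes "d \<noteq> 0" "\<And>a b c. ev3 d a b c \<noteq> 0 \<Longrightarrow> ev3 p a b c = 0" shows "p = 0"
proof -
  have "ev3 (d * p) a b c = 0" for a b c using assms(2)[of a b c] by auto
  then have "d * p = 0" by (rule ev3_zero_if_vanishes)
  then show ?thesis using assms(1) by simp
qed

text \<open>
  The polynomial \<open>p(xz, yz)\<close>. Its coefficient at \<open>z\<^sup>k\<close> is the homogeneous component of \<open>p\<close>
  of degree \<open>k\<close>, so lowest homogeneous components are split off by dividing by powers of \<open>z\<close>.
\<close>

definition dilate :: "real poly poly \<Rightarrow> real poly poly poly" where
  "dilate p = subst2 (\<lambda>r. [:[:[:r:]:]:]) p [:0, [:[:0, 1:]:]:] [:0, [:0, 1:]:]"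

lemma rhom_const3': "rhom (\<lambda>r::real. [:[:[:r:]:]:])" by (simp add: rhom_def one_pCons)

lemma rhom_dilate: "rhom dilate"
  using rhom_subst2[OF rhom_const3'] unfolding dilate_def .

lemma ev3_dilate: "ev3 (dilate p) a b c = ev2 p (a * c) (b * c)"
  unfolding dilate_def
  by (subst rhom_comm_subst2[OF rhom_ev3]) (simp_all add: ev3_pCons ev2_pCons mult.commute)

lemma ev3_const: "ev3 [:p:] a b c = ev2 p a b" by (simp add: ev3_pCons)

lemma dilate_eq_0_iff: "dilate p = 0 \<longleftrightarrow> p = 0"
proof
  assume "dilate p = 0"
  then have "ev2 p a b = 0" for a b using ev3_dilate[of p a b 1] by simp
  then show "p = 0" by (rule ev2_zero_if_vanishes)
qed (simp add: rhomD[OF rhom_dilate])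

definition homogeneous :: "nat \<Rightarrow> real poly poly \<Rightarrow> bool" where
  "homogeneous k p \<longleftrightarrow> (\<forall>a b t. ev2 p (a * t) (b * t) = t ^ k * ev2 p a b)"

lemma homogeneous_coeff_dilate: "homogeneous k (coeff (dilate p) k)"
  unfolding homogeneous_def
proof (intro allI)
  fix a b t
  define L where "L = map_poly (\<lambda>q. ev2 q (a * t) (b * t)) (dilate p)"
  define M where "M = map_poly (\<lambda>q. ev2 q a b) (dilate p)"
  have "poly L s = poly (pcompose M [:0, t:]) s" for s
    using ev3_dilate[of p "a * t" "b * t" s] ev3_dilate[of p a b "t * s"]
    by (simp add: L_def M_def ev3_def poly_pcompose mult_ac)
  then have "L = pcompose M [:0, t:]" by (simp add: poly_eq_poly_eq_iff[symmetric] ext)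
  then have "coeff L k = t ^ k * coeff M k" by (simp add: coeff_pcompose_linear)
  then show "ev2 (coeff (dilate p) k) (a * t) (b * t) = t ^ k * ev2 (coeff (dilate p) k) a b"
    by (simp add: L_def M_def coeff_map_poly)
qed

text \<open>
  In two variables a form of degree \<open>k\<close> is \<open>a\<^sup>k h(b / a)\<close> for a univariate polynomial \<open>h\<close>, so
  its zeros lie on finitely many lines through the origin.
\<close>

lemma homogeneous_zeros:
  assumes "homogeneous k H" "H \<noteq> 0"
  shows "\<exists>S. finite S \<and> (\<forall>a b. ev2 H a b = 0 \<longrightarrow> a = 0 \<or> (\<exists>r\<in>S. b = r * a))"
proof -
  define h where "h = map_poly (\<lambda>q. poly q 1) H"
  have h: "poly h T = ev2 H 1 T" for T by (simp add: h_def subst2_def map_poly_idI)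
  have H: "ev2 H a b = a ^ k * poly h (b / a)" if "a \<noteq> 0" for a b
    using assms(1)[unfolded homogeneous_def, rule_format, of 1 a "b / a"] that by (simp add: h)
  have "h \<noteq> 0"
  proof
    assume "h = 0"
    then have "H = 0"
      by (intro ev2_generic_zero[of "[:[:0, 1:]:]"]) (auto simp: ev2_pCons H)
    with assms(2) show False by simp
  qed
  then have "finite {x. poly h x = 0}" by (rule poly_roots_finite)
  moreover have "a = 0 \<or> (\<exists>r\<in>{x. poly h x = 0}. b = r * a)" if "ev2 H a b = 0" for a b
    using H[of a b] that by (cases "a = 0") (auto intro!: bexI[of _ "b / a"])
  ultimately show ?thesis by blast
qed

lemma tendsto_eval:
  fixes h :: "'c \<Rightarrow> 'a::comm_ring_1 \<Rightarrow> real"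
  assumes "\<And>x. ((\<lambda>c. h c x) \<longlongrightarrow> k x) F" "(u \<longlongrightarrow> l) F" "\<And>c. h c 0 = 0" "k 0 = 0"
  shows "((\<lambda>c. poly (map_poly (h c) p) (u c)) \<longlongrightarrow> poly (map_poly k p) l) F"
  by (induction p) (auto simp: map_poly_pCons assms(3,4) intro!: tendsto_intros assms(1,2))

lemma tendsto_ev2 [tendsto_intros]:
  assumes "(u \<longlongrightarrow> a) F" "(v \<longlongrightarrow> b) F" shows "((\<lambda>c. ev2 p (u c) (v c)) \<longlongrightarrow> ev2 p a b) F"
  unfolding subst2_def by (intro tendsto_eval assms tendsto_const) auto

lemma tendsto_ev3 [tendsto_intros]:
  assumes "(u \<longlongrightarrow> a) F" "(v \<longlongrightarrow> b) F" "(w \<longlongrightarrow> e) F"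
  shows "((\<lambda>c. ev3 p (u c) (v c) (w c)) \<longlongrightarrow> ev3 p a b e) F"
  unfolding ev3_def by (intro tendsto_eval tendsto_ev2 assms tendsto_const) auto

section \<open>From rational functions to their real values\<close>

text \<open>
  \<open>r\<close> is the value of \<open>U\<close> at a real point where some representation of \<open>U\<close> has a nonzero
  denominator. As a relation it is compatible with the field operations without any bookkeeping of
  reduced representations.
\<close>

definition specializes :: "ratfun3 \<Rightarrow> real \<Rightarrow> real \<Rightarrow> real \<Rightarrow> real \<Rightarrow> bool" where
  "specializes U a b c r \<longleftrightarrow> (\<exists>n d. U = Fract n d \<and> ev3 d a b c \<noteq> 0 \<and> r = ev3 n a b c / ev3 d a b c)"

lemma specializesI: "ev3 d a b c \<noteq> 0 \<Longrightarrow> specializes (Fract n d) a b c (ev3 n a b c / ev3 d a b c)"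
  by (auto simp: specializes_def)

lemma specializesE:
  assumes "specializes U a b c r"
  obtains n d where "U = Fract n d" "d \<noteq> 0" "ev3 d a b c \<noteq> 0" "r = ev3 n a b c / ev3 d a b c"
proof -
  obtain n d where *: "U = Fract n d" "ev3 d a b c \<noteq> 0" "r = ev3 n a b c / ev3 d a b c"
    using assms by (auto simp: specializes_def)
  moreover have "d \<noteq> 0" using *(2) by auto
  ultimately show thesis using that by blast
qed

lemma specializes_unique:
  assumes "specializes U a b c r" "specializes U a b c s" shows "r = s"
proof -
  obtain n d where 1: "U = Fract n d" "d \<noteq> 0" "ev3 d a b c \<noteq> 0" "r = ev3 n a b c / ev3 d a b c"
    using assms(1) by (rule specializesE)
  obtain n' d' where 2: "U = Fract n' d'" "d' \<noteq> 0" "ev3 d' a b c \<noteq> 0" "s = ev3 n' a b c / ev3 d' a b c"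
    using assms(2) by (rule specializesE)
  have "n * d' = n' * d" using 1 2 by (simp add: eq_fract)
  then have "ev3 (n * d') a b c = ev3 (n' * d) a b c" by (rule arg_cong)
  then show ?thesis unfolding 1(4) 2(4) using 1(3) 2(3) by (simp add: frac_eq_eq)
qed

lemma specializes_ring:
  assumes "specializes U a b c r" "specializes V a b c s"
  shows "specializes (U + V) a b c (r + s)" "specializes (U - V) a b c (r - s)"
    "specializes (U * V) a b c (r * s)" "s \<noteq> 0 \<Longrightarrow> specializes (U / V) a b c (r / s)"
proof -
  obtain n d where 1: "U = Fract n d" "d \<noteq> 0" "ev3 d a b c \<noteq> 0" "r = ev3 n a b c / ev3 d a b c"
    using assms(1) by (rule specializesE)
  obtain n' d' where 2: "V = Fract n' d'" "d' \<noteq> 0" "ev3 d' a b c \<noteq> 0" "s = ev3 n' a b c / ev3 d' a b c"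
    using assms(2) by (rule specializesE)
  show "specializes (U + V) a b c (r + s)"
    unfolding 1(4) 2(4) using 1(1-3) 2(1-3) specializesI[of "d * d'" a b c "n * d' + n' * d"]
    by (simp add: add_frac_eq)
  show "specializes (U - V) a b c (r - s)"
    unfolding 1(4) 2(4) using 1(1-3) 2(1-3) specializesI[of "d * d'" a b c "n * d' - n' * d"]
    by (simp add: diff_frac_eq)
  show "specializes (U * V) a b c (r * s)"
    unfolding 1(4) 2(4) using 1(1-3) 2(1-3) specializesI[of "d * d'" a b c "n * n'"] by simp
  show "specializes (U / V) a b c (r / s)" if "s \<noteq> 0"
    unfolding 1(4) 2(4) using that[unfolded 2(4)] 1(1-3) 2(1-3) specializesI[of "d * n'" a b c "n * d'"]
    by (simp add: mult.commute)
qed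

lemma specializes_Fract1: "specializes (Fract p 1) a b c (ev3 p a b c)"
  using specializesI[of 1 a b c p] by simp

lemma specializes_basic:
  "specializes (const3 t) a b c t" "specializes X3 a b c a" "specializes Y3 a b c b"
  "specializes Z3 a b c c" "specializes 0 a b c 0" "specializes 1 a b c 1"
  unfolding const3_def X3_def Y3_def Z3_def Zero_fract_def One_fract_def
  using specializes_Fract1[of _ a b c]
  by (metis (no_types, lifting) ev2_pCons ev3_pCons ev3_simps(1,2) ev2_simps(1,2) poly_pCons poly_0
      mult_zero_right mult_1_right add_0_left add_0_right poly_1)+

lemma specializes_eval:
  assumes "\<And>x. specializes (h x) a b c (k x)" "specializes U a b c r" "h 0 = 0" "k 0 = 0"
  shows "specializes (poly (map_poly h p) U) a b c (poly (map_poly k p) r)"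
proof (induction p)
  case 0
  show ?case by (simp add: specializes_basic)
next
  case (pCons x p)
  then show ?case
    using specializes_ring(1)[OF assms(1) specializes_ring(3)[OF assms(2) pCons.IH]]
    by (simp add: map_poly_pCons assms(3,4))
qed

lemma const3_0: "const3 0 = 0" by (simp add: const3_def fract_collapse)

lemma specializes_poly2:
  assumes "specializes U a b c r" "specializes V a b c s"
  shows "specializes (poly2 const3 p U V) a b c (ev2 p r s)"
  unfolding poly2_def subst2_def
  by (intro specializes_eval specializes_basic assms) (simp_all add: const3_0)

lemma specializes_ratfun_eval:
  assumes "specializes U a b c r" "specializes V a b c s" "quot_of_fract f = (p, q)" "ev2 q r s \<noteq> 0"
  shows "specializes (ratfun_eval const3 f U V) a b c (ev2 p r s / ev2 q r s)"
  unfolding ratfun_eval_def using assms by (auto intro!: specializes_ring specializes_poly2)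

text \<open>
  The functional equation holds at every real point where the denominators of the inner
  substitutions do not vanish; the outer denominators are cleared. The last claim is what remains
  of the well-definedness of the composition: both outer
  denominators are nonzero at some common point.
\<close>

lemma translation_equation_real:
  assumes eq: "translation_equation (u, v)"
    and u: "quot_of_fract u = (p1, q1)" and v: "quot_of_fract v = (p2, q2)"
    and D: "D = q1 * q2"
  defines "F1 \<equiv> \<lambda>a b. ev2 p1 a b / ev2 q1 a b" and "F2 \<equiv> \<lambda>a b. ev2 p2 a b / ev2 q2 a b"
  defines "w1 \<equiv> \<lambda>a b c. F1 (a * c) (b * c) * ((1 - c) / c)"
    and "w2 \<equiv> \<lambda>a b c. F2 (a * c) (b * c) * ((1 - c) / c)"
  shows "\<And>a b c. \<lbrakk>c \<noteq> 0; ev2 D a b \<noteq> 0; ev2 D (a * c) (b * c) \<noteq> 0\<rbrakk> \<Longrightarrow>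
      (1 - c) * F1 a b * ev2 q1 (w1 a b c) (w2 a b c) = ev2 p1 (w1 a b c) (w2 a b c)"
    and "\<And>a b c. \<lbrakk>c \<noteq> 0; ev2 D a b \<noteq> 0; ev2 D (a * c) (b * c) \<noteq> 0\<rbrakk> \<Longrightarrow>
      (1 - c) * F2 a b * ev2 q2 (w1 a b c) (w2 a b c) = ev2 p2 (w1 a b c) (w2 a b c)"
    and "\<exists>a b c. c \<noteq> 0 \<and> ev2 D a b \<noteq> 0 \<and> ev2 D (a * c) (b * c) \<noteq> 0 \<and>
      ev2 q1 (w1 a b c) (w2 a b c) \<noteq> 0 \<and> ev2 q2 (w1 a b c) (w2 a b c) \<noteq> 0"
proof -
  define W1 where "W1 = (1 - Z3) / Z3 * ratfun_eval const3 u (X3 * Z3) (Y3 * Z3)"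
  define W2 where "W2 = (1 - Z3) / Z3 * ratfun_eval const3 v (X3 * Z3) (Y3 * Z3)"
  have def1: "poly2 const3 q1 W1 W2 \<noteq> 0" and def2: "poly2 const3 q2 W1 W2 \<noteq> 0"
    and "(1 - Z3) * ratfun_eval const3 u X3 Y3 = ratfun_eval const3 u W1 W2"
    and "(1 - Z3) * ratfun_eval const3 v X3 Y3 = ratfun_eval const3 v W1 W2"
    using eq u v unfolding translation_equation_def Let_def pair_defined_at_def
      ratfun_defined_at_def scale_pair_def pair_eval_def W1_def W2_def by auto
  then have eq1: "(1 - Z3) * ratfun_eval const3 u X3 Y3 * poly2 const3 q1 W1 W2 = poly2 const3 p1 W1 W2"
    and eq2: "(1 - Z3) * ratfun_eval const3 v X3 Y3 * poly2 const3 q2 W1 W2 = poly2 const3 p2 W1 W2"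
    using u v by (auto simp: ratfun_eval_def)
  have spec: "specializes W1 a b c (w1 a b c)" "specializes W2 a b c (w2 a b c)"
    "specializes (ratfun_eval const3 u X3 Y3) a b c (F1 a b)"
    "specializes (ratfun_eval const3 v X3 Y3) a b c (F2 a b)"
    if "c \<noteq> 0" "ev2 D a b \<noteq> 0" "ev2 D (a * c) (b * c) \<noteq> 0" for a b c
    using that unfolding W1_def W2_def w1_def w2_def F1_def F2_def D mult.commute[of _ "(1 - c) / c"]
    by (intro specializes_ring specializes_ratfun_eval specializes_basic u v; simp)+
  show "(1 - c) * F1 a b * ev2 q1 (w1 a b c) (w2 a b c) = ev2 p1 (w1 a b c) (w2 a b c)"
    if "c \<noteq> 0" "ev2 D a b \<noteq> 0" "ev2 D (a * c) (b * c) \<noteq> 0" for a b c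
    by (rule specializes_unique[OF _ specializes_poly2[OF spec(1,2)[OF that]]], subst eq1[symmetric])
      (intro specializes_ring specializes_poly2 specializes_basic spec that)
  show "(1 - c) * F2 a b * ev2 q2 (w1 a b c) (w2 a b c) = ev2 p2 (w1 a b c) (w2 a b c)"
    if "c \<noteq> 0" "ev2 D a b \<noteq> 0" "ev2 D (a * c) (b * c) \<noteq> 0" for a b c
    by (rule specializes_unique[OF _ specializes_poly2[OF spec(1,2)[OF that]]], subst eq2[symmetric])
      (intro specializes_ring specializes_poly2 specializes_basic spec that)
  obtain n d where nd: "poly2 const3 q1 W1 W2 * poly2 const3 q2 W1 W2 = Fract n d" "d \<noteq> 0"
    by (cases "poly2 const3 q1 W1 W2 * poly2 const3 q2 W1 W2" rule: Fract_cases)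
  have "D \<noteq> 0" using u v D by (metis mult_eq_0_iff snd_conv snd_quot_of_fract_nonzero)
  moreover have "n \<noteq> 0"
  proof
    assume "n = 0"
    then have "poly2 const3 q1 W1 W2 * poly2 const3 q2 W1 W2 = 0"
      using nd by (simp add: fract_collapse)
    then show False using def1 def2 by simp
  qed
  ultimately have "n * d * [:0, 1:] * [:D:] * dilate D \<noteq> 0"
    using nd(2) by (simp add: dilate_eq_0_iff)
  then obtain a b c where "ev3 (n * d * [:0, 1:] * [:D:] * dilate D) a b c \<noteq> 0"
    using ev3_zero_if_vanishes by blast
  then have *: "ev3 n a b c \<noteq> 0" "ev3 d a b c \<noteq> 0" and "ev3 [:0, 1:] a b c \<noteq> 0"
    and good: "ev2 D a b \<noteq> 0" "ev2 D (a * c) (b * c) \<noteq> 0"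
    unfolding ev3_simps ev3_const ev3_dilate by simp_all
  then have "c \<noteq> 0" by (simp add: ev3_pCons)
  note good = this good
  have "ev2 q1 (w1 a b c) (w2 a b c) * ev2 q2 (w1 a b c) (w2 a b c) = ev3 n a b c / ev3 d a b c"
    using specializesI[OF *(2), of n] unfolding nd(1)[symmetric]
    by (rule specializes_unique[rotated]) (intro specializes_ring specializes_poly2 spec good)
  with * good show "\<exists>a b c. c \<noteq> 0 \<and> ev2 D a b \<noteq> 0 \<and> ev2 D (a * c) (b * c) \<noteq> 0 \<and>
      ev2 q1 (w1 a b c) (w2 a b c) \<noteq> 0 \<and> ev2 q2 (w1 a b c) (w2 a b c) \<noteq> 0"
    by (metis divide_eq_0_iff mult_eq_0_iff)
qed

lemma rhom_to_fract: "rhom (\<lambda>p. Fract p 1)"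
  by (simp add: rhom_def fract_collapse)

lemma poly2_const3_generic:
  "poly2 const3 P (X3 * Z3) (Y3 * Z3) = Fract (dilate P) 1" "poly2 const3 P X3 Y3 = Fract [:P:] 1"
proof -
  have *: "[:P:] = subst2 (\<lambda>r. [:[:[:r:]:]:]) P [:[:[:0, 1:]:]:] [:[:0, 1:]:]" (is "_ = ?r")
  proof -
    have "ev3 ([:P:] - ?r) a b c = 0" for a b c
      unfolding ev3_simps
      by (subst rhom_comm_subst2[OF rhom_ev3]) (simp_all add: ev3_const ev3_pCons[of _ 0] ev2_pCons)
    then show ?thesis using ev3_zero_if_vanishes by fastforce
  qed
  show "poly2 const3 P (X3 * Z3) (Y3 * Z3) = Fract (dilate P) 1"
    unfolding dilate_def poly2_eq_subst2
    by (subst rhom_comm_subst2[OF rhom_to_fract])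
      (simp_all add: const3_def[abs_def] X3_def Y3_def Z3_def)
  show "poly2 const3 P X3 Y3 = Fract [:P:] 1"
    unfolding * poly2_eq_subst2
    by (subst rhom_comm_subst2[OF rhom_to_fract])
      (simp_all add: const3_def[abs_def] X3_def Y3_def Z3_def)
qed

text \<open>
  With denominators cleared, homogeneity is a polynomial identity, which can then be verified at
  real points.
\<close>

lemma one_homogeneousI:
  assumes "quot_of_fract R = (P, Q)" "dilate P * [:Q:] = [:0, 1:] * [:P:] * dilate Q"
  shows "one_homogeneous R"
proof -
  have "Q \<noteq> 0" using assms(1) by (metis snd_conv snd_quot_of_fract_nonzero)
  then show ?thesis
    using assms unfolding one_homogeneous_def ratfun_eval_def poly2_const3_generic
    by (simp add: Z3_def eq_fract dilate_eq_0_iff mult_ac)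
qed

section \<open>Homogeneous components and the limit at the origin\<close>

lemma ev3_at_0: "ev3 p a b 0 = ev2 (coeff p 0) a b"
  by (cases p) (simp add: ev3_pCons)

lemma ev3_lowest:
  assumes "dilate p = [:0, 1:] ^ k * p'"
  shows "ev2 p (a * c) (b * c) = c ^ k * ev3 p' a b c"
  unfolding ev3_dilate[symmetric] assms by (simp add: ev3_pCons)

lemma coeff_X_power: "coeff ([:0, 1:] ^ k * p) k = coeff (p :: 'a::comm_ring_1 poly) 0"
  by (induction k) (simp_all add: mult.assoc)

lemma split_off_X_power:
  fixes p :: "'a::idom poly"
  assumes "p \<noteq> 0"
  obtains k p' where "p = [:0, 1:] ^ k * p'" "coeff p' 0 \<noteq> 0"
proof -
  obtain p' where p': "p = [:0, 1:] ^ order 0 p * p'" "\<not> [:0, 1:] dvd p'"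
    using order_decomp[OF assms, of 0] by auto
  moreover have "coeff p' 0 \<noteq> 0"
    using p'(2) poly_eq_0_iff_dvd[of p' 0] by (simp add: poly_0_coeff_0)
  ultimately show thesis using that by blast
qed

lemma limits_agree:
  fixes f g :: "real \<Rightarrow> real"
  assumes "\<forall>\<^sub>F c in at x. f c = g c" "(f \<longlongrightarrow> a) (at x)" "(g \<longlongrightarrow> b) (at x)"
  shows "a = b"
proof (rule tendsto_unique[OF at_neq_bot assms(2)])
  show "(f \<longlongrightarrow> b) (at x)"
  proof (rule Lim_transform_eventually[OF assms(3)])
    show "\<forall>\<^sub>F c in at x. g c = f c" using assms(1) by eventually_elim simp
  qed
qed

lemma eventually_ev2_nonzero:
  assumes "ev2 D a b \<noteq> 0" shows "\<forall>\<^sub>F c in at 1. ev2 D (a * c) (b * c) \<noteq> 0"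
proof -
  have "((\<lambda>c. ev2 D (a * c) (b * c)) \<longlongrightarrow> ev2 D (a * 1) (b * 1)) (at 1)"
    by (intro tendsto_intros)
  then show ?thesis by (rule tendsto_imp_eventually_ne) (simp add: assms)
qed

text \<open>
  The first half of the classification. Here \<open>Y = (Y1, Y2)\<close> is the pair \<open>\<phi>\<close>, \<open>p / q\<close> is one of its
  components and the linear form \<open>l\<close> is the corresponding coordinate. As \<open>c \<rightarrow> 1\<close> the
  argument of \<open>p\<close> and \<open>q\<close> tends to the origin along \<open>Y\<close>, so comparing lowest order terms
  forces a homogeneous polynomial to vanish at \<open>Y\<close>: the lowest form of \<open>p\<close> if its degree is at most
  the degree \<open>m\<close> of the lowest form \<open>d\<close> of \<open>q\<close>, and the component of \<open>p\<close> of degree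
  \<open>m + 1\<close> minus \<open>l d\<close> otherwise. If that polynomial is zero, then \<open>p / q\<close> has \<open>l\<close> as its
  leading behaviour at the origin, which is the limit condition.
\<close>

lemma component_dichotomy:
  assumes q: "q \<noteq> 0" and l: "homogeneous 1 l"
    and Y: "\<And>a b. ev2 D a b \<noteq> 0 \<Longrightarrow> ((\<lambda>c. Y1 (a * c) (b * c)) \<longlongrightarrow> Y1 a b) (at 1)"
      "\<And>a b. ev2 D a b \<noteq> 0 \<Longrightarrow> ((\<lambda>c. Y2 (a * c) (b * c)) \<longlongrightarrow> Y2 a b) (at 1)"
    and eq: "\<And>a b c. \<lbrakk>c \<noteq> 0; ev2 D a b \<noteq> 0; ev2 D (a * c) (b * c) \<noteq> 0\<rbrakk> \<Longrightarrow>
      (1 - c) * ev2 l (Y1 a b) (Y2 a b) *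
        ev2 q (Y1 (a * c) (b * c) * ((1 - c) / c)) (Y2 (a * c) (b * c) * ((1 - c) / c)) =
        ev2 p (Y1 (a * c) (b * c) * ((1 - c) / c)) (Y2 (a * c) (b * c) * ((1 - c) / c))"
  shows "(\<exists>k H. homogeneous k H \<and> H \<noteq> 0 \<and> (\<forall>a b. ev2 D a b \<noteq> 0 \<longrightarrow> ev2 H (Y1 a b) (Y2 a b) = 0)) \<or>
    (\<exists>d. d \<noteq> 0 \<and> (\<forall>a b. ev2 d a b \<noteq> 0 \<longrightarrow>
      ((\<lambda>z. ev2 p (a * z) (b * z) / ev2 q (a * z) (b * z) / z) \<longlongrightarrow> ev2 l a b) (at 0)))"
proof -
  obtain m q' where q': "dilate q = [:0, 1:] ^ m * q'" "coeff q' 0 \<noteq> 0"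
    using split_off_X_power[of "dilate q"] q by (auto simp: dilate_eq_0_iff)
  define d where "d = coeff q' 0"
  have d: "d \<noteq> 0" "d = coeff (dilate q) m"
    using q' by (simp_all add: d_def coeff_X_power)
  note ev_q = ev3_lowest[OF q'(1)]
  define e :: "real \<Rightarrow> real" where "e c = (1 - c) / c" for c
  have e: "(e \<longlongrightarrow> 0) (at 1)"
  proof -
    have "((\<lambda>c. (1 - c) / c) \<longlongrightarrow> (1 - 1) / 1) (at (1::real))"
      by (intro tendsto_intros) simp
    then show ?thesis by (simp add: e_def[abs_def])
  qed
  have near: "\<forall>\<^sub>F c in at 1. c \<noteq> 0 \<and> e c \<noteq> 0 \<and> ev2 D (a * c) (b * c) \<noteq> 0 \<and> 1 - c = c * e c"
    if "ev2 D a b \<noteq> 0" for a b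
  proof -
    have "\<forall>\<^sub>F c in at (1::real). c \<noteq> 0"
      by (rule tendsto_imp_eventually_ne[OF tendsto_ident_at]) simp
    moreover have "\<forall>\<^sub>F c in at (1::real). c \<noteq> 1" by (rule eventually_neq_at_within)
    ultimately show ?thesis using eventually_ev2_nonzero[OF that]
      by eventually_elim (auto simp: e_def)
  qed
  show ?thesis
  proof (cases "[:0, 1:] ^ Suc m dvd dilate p")
    case True
    then obtain p' where p': "dilate p = [:0, 1:] ^ Suc m * p'" by blast
    note ev_p = ev3_lowest[OF p']
    define H where "H = coeff p' 0 - l * d"
    have "homogeneous (Suc m) H"
      using homogeneous_coeff_dilate[of "Suc m" p] homogeneous_coeff_dilate[of m q] l
      unfolding H_def d(2) p' coeff_X_power by (auto simp: homogeneous_def algebra_simps)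
    moreover have "ev2 H (Y1 a b) (Y2 a b) = 0" if D: "ev2 D a b \<noteq> 0" for a b
    proof -
      let ?y1 = "\<lambda>c. Y1 (a * c) (b * c)" and ?y2 = "\<lambda>c. Y2 (a * c) (b * c)"
      have "\<forall>\<^sub>F c in at 1. c * ev2 l (Y1 a b) (Y2 a b) * ev3 q' (?y1 c) (?y2 c) (e c) =
          ev3 p' (?y1 c) (?y2 c) (e c)"
        using near[OF D]
      proof eventually_elim
        case (elim c)
        then have "1 - c = c * e c" and "e c \<noteq> 0" by simp_all
        have "(1 - c) * ev2 l (Y1 a b) (Y2 a b) * (e c ^ m * ev3 q' (?y1 c) (?y2 c) (e c)) =
            e c ^ Suc m * ev3 p' (?y1 c) (?y2 c) (e c)"
          using eq[OF _ D, of c] elim unfolding e_def[symmetric] ev_q ev_p by blast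
        then have E: "(c * e c) * ev2 l (Y1 a b) (Y2 a b) * (e c ^ m * ev3 q' (?y1 c) (?y2 c) (e c)) =
            e c ^ Suc m * ev3 p' (?y1 c) (?y2 c) (e c)"
          unfolding \<open>1 - c = c * e c\<close> .
        have "e c ^ Suc m * (c * ev2 l (Y1 a b) (Y2 a b) * ev3 q' (?y1 c) (?y2 c) (e c)) =
            e c ^ Suc m * ev3 p' (?y1 c) (?y2 c) (e c)"
          using E by (simp add: mult_ac)
        then show ?case using \<open>e c \<noteq> 0\<close> by simp
      qed
      moreover have "((\<lambda>c. c * ev2 l (Y1 a b) (Y2 a b) * ev3 q' (?y1 c) (?y2 c) (e c)) \<longlongrightarrow>
          1 * ev2 l (Y1 a b) (Y2 a b) * ev3 q' (Y1 a b) (Y2 a b) 0) (at 1)"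
        by (intro tendsto_intros Y[OF D] e)
      moreover have "((\<lambda>c. ev3 p' (?y1 c) (?y2 c) (e c)) \<longlongrightarrow> ev3 p' (Y1 a b) (Y2 a b) 0) (at 1)"
        by (intro tendsto_intros Y[OF D] e)
      ultimately have "1 * ev2 l (Y1 a b) (Y2 a b) * ev3 q' (Y1 a b) (Y2 a b) 0 = ev3 p' (Y1 a b) (Y2 a b) 0"
        by (rule limits_agree)
      then show ?thesis by (simp add: H_def d_def ev3_at_0)
    qed
    moreover have "((\<lambda>z. ev2 p (a * z) (b * z) / ev2 q (a * z) (b * z) / z) \<longlongrightarrow> ev2 l a b) (at 0)"
      if "H = 0" and dne: "ev2 d a b \<noteq> 0" for a b
    proof -
      have "((\<lambda>z. ev3 p' a b z / ev3 q' a b z) \<longlongrightarrow> ev3 p' a b 0 / ev3 q' a b 0) (at 0)"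
        by (intro tendsto_intros) (simp add: ev3_at_0 d_def[symmetric] dne)
      moreover have "ev3 p' a b 0 / ev3 q' a b 0 = ev2 l a b"
        using that by (simp add: ev3_at_0 H_def d_def)
      moreover have "\<forall>\<^sub>F z in at 0. ev3 p' a b z / ev3 q' a b z =
          ev2 p (a * z) (b * z) / ev2 q (a * z) (b * z) / z"
        using eventually_neq_at_within[of "0::real" 0 UNIV]
        by eventually_elim (simp add: ev_p ev_q)
      ultimately show ?thesis using Lim_transform_eventually by fastforce
    qed
    ultimately show ?thesis using d(1) by (cases "H = 0") blast+
  next
    case False
    then have p: "dilate p \<noteq> 0" by auto
    obtain k p' where p': "dilate p = [:0, 1:] ^ k * p'" "coeff p' 0 \<noteq> 0"
      using split_off_X_power[OF p] .
    have "k \<le> m"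
    proof (rule ccontr)
      assume "\<not> k \<le> m"
      then have "[:0, 1:] ^ Suc m dvd ([:0, 1:] ^ k :: real poly poly poly)"
        by (intro le_imp_power_dvd) simp
      then show False using False p'(1) by auto
    qed
    note ev_p = ev3_lowest[OF p'(1)]
    define H where "H = coeff p' 0"
    have H: "H \<noteq> 0" "H = coeff (dilate p) k"
      using p' by (simp_all add: H_def coeff_X_power)
    moreover have "ev2 H (Y1 a b) (Y2 a b) = 0" if D: "ev2 D a b \<noteq> 0" for a b
    proof -
      let ?y1 = "\<lambda>c. Y1 (a * c) (b * c)" and ?y2 = "\<lambda>c. Y2 (a * c) (b * c)"
      have "\<forall>\<^sub>F c in at 1. c * e c ^ Suc (m - k) * ev2 l (Y1 a b) (Y2 a b) * ev3 q' (?y1 c) (?y2 c) (e c) =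
          ev3 p' (?y1 c) (?y2 c) (e c)"
        using near[OF D]
      proof eventually_elim
        case (elim c)
        then have "1 - c = c * e c" and "e c \<noteq> 0" by simp_all
        have pow: "e c ^ k * e c ^ Suc (m - k) = e c * e c ^ m"
          unfolding power_add[symmetric] power_Suc[symmetric] using \<open>k \<le> m\<close> by simp
        have "(1 - c) * ev2 l (Y1 a b) (Y2 a b) * (e c ^ m * ev3 q' (?y1 c) (?y2 c) (e c)) =
            e c ^ k * ev3 p' (?y1 c) (?y2 c) (e c)"
          using eq[OF _ D, of c] elim unfolding e_def[symmetric] ev_q ev_p by blast
        then have "(c * e c) * ev2 l (Y1 a b) (Y2 a b) * (e c ^ m * ev3 q' (?y1 c) (?y2 c) (e c)) =
            e c ^ k * ev3 p' (?y1 c) (?y2 c) (e c)"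
          unfolding \<open>1 - c = c * e c\<close> .
        then have E: "c * (e c ^ k * e c ^ Suc (m - k)) * ev2 l (Y1 a b) (Y2 a b) * ev3 q' (?y1 c) (?y2 c) (e c) =
            e c ^ k * ev3 p' (?y1 c) (?y2 c) (e c)"
          unfolding pow by (simp add: mult_ac)
        have "e c ^ k * (c * e c ^ Suc (m - k) * ev2 l (Y1 a b) (Y2 a b) * ev3 q' (?y1 c) (?y2 c) (e c)) =
            e c ^ k * ev3 p' (?y1 c) (?y2 c) (e c)"
          using E by (simp add: mult_ac)
        then show ?case using \<open>e c \<noteq> 0\<close> by simp
      qed
      moreover have "((\<lambda>c. c * e c ^ Suc (m - k) * ev2 l (Y1 a b) (Y2 a b) * ev3 q' (?y1 c) (?y2 c) (e c)) \<longlongrightarrow>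
          1 * 0 ^ Suc (m - k) * ev2 l (Y1 a b) (Y2 a b) * ev3 q' (Y1 a b) (Y2 a b) 0) (at 1)"
        by (intro tendsto_intros Y[OF D] e)
      moreover have "((\<lambda>c. ev3 p' (?y1 c) (?y2 c) (e c)) \<longlongrightarrow> ev3 p' (Y1 a b) (Y2 a b) 0) (at 1)"
        by (intro tendsto_intros Y[OF D] e)
      ultimately have "1 * 0 ^ Suc (m - k) * ev2 l (Y1 a b) (Y2 a b) * ev3 q' (Y1 a b) (Y2 a b) 0 = ev3 p' (Y1 a b) (Y2 a b) 0"
        by (rule limits_agree)
      then show ?thesis by (simp add: H_def ev3_at_0)
    qed
    ultimately show ?thesis using homogeneous_coeff_dilate by blast
  qed
qed

section \<open>Proportional components and the behaviour along rays\<close>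

text \<open>
  The direction of \<open>(p1 / q1, p2 / q2)\<close> takes only finitely many values, hence it is constant: a
  product of the corresponding polynomials vanishes identically, so one factor does.
\<close>

lemma homogeneous_relation_imp_proportional:
  assumes H: "homogeneous k H" "H \<noteq> 0" and D: "q1 * q2 \<noteq> 0"
    and rel: "\<And>a b. ev2 (q1 * q2) a b \<noteq> 0 \<Longrightarrow>
      ev2 H (ev2 p1 a b / ev2 q1 a b) (ev2 p2 a b / ev2 q2 a b) = 0"
  shows "p1 = 0 \<or> (\<exists>r. p2 * q1 = [:[:r:]:] * (p1 * q2))"
proof -
  obtain S where S: "finite S" "\<And>a b. ev2 H a b = 0 \<Longrightarrow> a = 0 \<or> (\<exists>r\<in>S. b = r * a)"
    using homogeneous_zeros[OF H] by blast
  define L where "L r = p2 * q1 - [:[:r:]:] * (p1 * q2)" for r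
  have ev_L: "ev2 (L r) a b = ev2 p2 a b * ev2 q1 a b - r * (ev2 p1 a b * ev2 q2 a b)" for r a b
    unfolding L_def ev2_simps by (simp add: ev2_pCons)
  have "p1 * (\<Prod>r\<in>S. L r) = 0"
  proof (rule ev2_generic_zero[OF D])
    fix a b assume D: "ev2 (q1 * q2) a b \<noteq> 0"
    then have nz: "ev2 q1 a b \<noteq> 0" "ev2 q2 a b \<noteq> 0" by auto
    from S(2)[OF rel[OF D]] nz have "ev2 p1 a b = 0 \<or> (\<exists>r\<in>S. ev2 (L r) a b = 0)"
      by (auto simp: ev_L field_simps)
    then show "ev2 (p1 * (\<Prod>r\<in>S. L r)) a b = 0"
      using S(1) by (auto simp: prod.remove)
  qed
  then show ?thesis using S(1) unfolding L_def by (auto simp del: mult_pCons_left)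
qed

text \<open>
  The restriction of \<open>p\<close> to the line through the origin and \<open>(a, b)\<close>.
\<close>

definition ray :: "real poly poly \<Rightarrow> real \<Rightarrow> real \<Rightarrow> real poly" where
  "ray p a b = map_poly (\<lambda>q. ev2 q a b) (dilate p)"

lemma poly_ray: "poly (ray p a b) t = ev2 p (a * t) (b * t)"
  using ev3_dilate[of p a b t] by (simp add: ray_def ev3_def)

lemma poly_eqI_eval:
  fixes p q :: "real poly" assumes "\<And>t. poly p t = poly q t" shows "p = q"
  using assms by (simp add: poly_eq_poly_eq_iff[symmetric] ext)

lemma ray_scaled: "ray p (a * t) (b * t) = pcompose (ray p a b) [:0, t:]"
  by (rule poly_eqI_eval) (simp add: poly_ray poly_pcompose mult_ac)

text \<open>
  A quotient \<open>P(\<tau>) / (\<tau> Q(\<tau>))\<close> has a finite nonzero limit at \<open>0\<close> only if the vanishing orders of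
  numerator and denominator agree, and the limit is then the quotient of the lowest coefficients.
\<close>

lemma limit_one_imp_orders:
  fixes P Q :: "real poly" and \<tau> :: "real \<Rightarrow> real"
  assumes Q: "Q = [:0, 1:] ^ k * Q'" "coeff Q' 0 \<noteq> 0"
    and \<tau>: "(\<tau> \<longlongrightarrow> 0) (at x)" "\<forall>\<^sub>F c in at x. \<tau> c \<noteq> 0"
    and lim: "((\<lambda>c. poly P (\<tau> c) / (\<tau> c * poly Q (\<tau> c))) \<longlongrightarrow> 1) (at x)"
  obtains P' where "P = [:0, 1:] ^ Suc k * P'" "coeff P' 0 = coeff Q' 0"
proof -
  have "P \<noteq> 0"
  proof
    assume "P = 0"
    then have "((\<lambda>c. 0) \<longlongrightarrow> (1::real)) (at x)" using lim by simp
    then show False using tendsto_unique[OF at_neq_bot _ tendsto_const] by fastforce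
  qed
  then obtain j P' where P: "P = [:0, 1:] ^ j * P'" "coeff P' 0 \<noteq> 0"
    by (rule split_off_X_power)
  have ev: "poly P y = y ^ j * poly P' y" "poly Q y = y ^ k * poly Q' y" for y
    by (simp_all add: P Q)
  have lim': "((\<lambda>c. poly R (\<tau> c)) \<longlongrightarrow> coeff R 0) (at x)" for R
    unfolding poly_0_coeff_0[symmetric] by (intro tendsto_intros \<tau>)
  \<comment> \<open>The exponents \<open>i\<close> and \<open>l\<close> absorb the difference of the two vanishing orders.\<close>
  have *: "coeff Q' 0 * 0 ^ i = coeff P' 0 * 0 ^ l"
    if "j + i = Suc k + l" "i = 0 \<or> l = 0" for i l
  proof -
    have "((\<lambda>c. poly P (\<tau> c) / (\<tau> c * poly Q (\<tau> c)) * (poly Q' (\<tau> c) * \<tau> c ^ i)) \<longlongrightarrow>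
        1 * (coeff Q' 0 * 0 ^ i)) (at x)"
      by (intro tendsto_intros lim lim' \<tau>)
    moreover have "((\<lambda>c. poly P' (\<tau> c) * \<tau> c ^ l) \<longlongrightarrow> coeff P' 0 * 0 ^ l) (at x)"
      by (intro tendsto_intros lim' \<tau>)
    moreover have "\<forall>\<^sub>F c in at x. poly Q' (\<tau> c) \<noteq> 0"
      by (rule tendsto_imp_eventually_ne[OF lim' Q(2)])
    with \<tau>(2) have "\<forall>\<^sub>F c in at x. poly P (\<tau> c) / (\<tau> c * poly Q (\<tau> c)) * (poly Q' (\<tau> c) * \<tau> c ^ i) =
        poly P' (\<tau> c) * \<tau> c ^ l"
    proof eventually_elim
      case (elim c)
      have "\<tau> c ^ j * \<tau> c ^ i = \<tau> c * \<tau> c ^ k * \<tau> c ^ l"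
        unfolding power_add[symmetric] that(1) by (simp add: power_add)
      then show ?case using elim by (simp add: ev field_simps)
    qed
    ultimately have "1 * (coeff Q' 0 * 0 ^ i) = coeff P' 0 * 0 ^ l"
      by (rule limits_agree[rotated])
    then show ?thesis by simp
  qed
  have "j = Suc k \<and> coeff P' 0 = coeff Q' 0"
  proof (cases "j \<le> Suc k")
    case True
    show ?thesis using *[of "Suc k - j" 0] True P(2) Q(2)
      by (cases "j = Suc k") (auto simp: power_0_left)
  next
    case False
    then show ?thesis using *[of 0 "j - Suc k"] P(2) Q(2) by auto
  qed
  then show thesis using that P by blast
qed

text \<open>
  The quotient \<open>W / P\<close> has derivative zero. In terms of polynomials: the hypothesis is linear in
  \<open>W\<close> and forces a nonzero \<open>W\<close> to have the degree of \<open>P\<close>, so subtracting the multiple of \<open>P\<close> that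
  cancels the leading term leaves zero.
\<close>

lemma pderiv_proportional:
  fixes W P :: "real poly"
  assumes "pderiv W * P = W * pderiv P" "P \<noteq> 0"
  shows "\<exists>\<kappa>. W = smult \<kappa> P"
proof -
  have deg: "degree V = degree P" if "pderiv V * P = V * pderiv P" "V \<noteq> 0" for V
  proof -
    have lc: "coeff (pderiv V * R) (degree V + degree R - 1) = real (degree V) * lead_coeff V * lead_coeff R"
      for V R :: "real poly"
    proof (cases "degree V = 0")
      case True
      then show ?thesis by (metis mult_zero_left coeff_0 of_nat_0 pderiv_eq_0_iff)
    next
      case False
      then have "coeff (pderiv V * R) (degree (pderiv V) + degree R) = lead_coeff (pderiv V) * lead_coeff R"
        by (simp add: coeff_mult_degree_sum)
      then show ?thesis using False
        by (simp add: degree_pderiv coeff_pderiv)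
    qed
    have "real (degree V) * lead_coeff V * lead_coeff P = real (degree P) * lead_coeff P * lead_coeff V"
      unfolding lc[symmetric] that(1) by (simp only: add.commute mult.commute)
    then show ?thesis using that(2) assms(2) by simp
  qed
  show ?thesis
  proof (cases "W = 0")
    case True then show ?thesis by (intro exI[of _ 0]) simp
  next
    case False
    define \<kappa> where "\<kappa> = lead_coeff W / lead_coeff P"
    define V where "V = W - smult \<kappa> P"
    have W: "degree W = degree P" using deg assms False by blast
    have V: "pderiv V * P = V * pderiv P"
      using assms(1) by (simp add: V_def pderiv_diff pderiv_smult algebra_simps)
    have 0: "coeff V (degree P) = 0" using assms(2) W by (simp add: V_def \<kappa>_def)
    have "V = 0"
    proof (rule ccontr)
      assume "V \<noteq> 0"
      then show False using deg[OF V] 0 by (metis leading_coeff_0_iff)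
    qed
    then show ?thesis by (auto simp: V_def)
  qed
qed
definition quotient_at :: "real poly poly \<Rightarrow> real poly poly \<Rightarrow> real \<Rightarrow> real \<Rightarrow> real" where
  "quotient_at p q a b = ev2 p a b / ev2 q a b"

lemma tendsto_quotient_at:
  assumes "ev2 q a b \<noteq> 0"
  shows "((\<lambda>c. quotient_at p q (a * c) (b * c)) \<longlongrightarrow> quotient_at p q a b) (at 1)"
proof -
  have "((\<lambda>c. quotient_at p q (a * c) (b * c)) \<longlongrightarrow> quotient_at p q (a * 1) (b * 1)) (at 1)"
    unfolding quotient_at_def by (intro tendsto_intros) (simp add: assms)
  then show ?thesis by simp
qed

text \<open>
  For a scalar \<open>F = p / q\<close> and \<open>g = Ph / Qh\<close> the equation reads
  \<open>(1 - c) F(x) = g(\<tau>)\<close> with \<open>\<tau> = F(xc) (1 - c) / c\<close>. Since \<open>1 - c = c \<tau> / F(xc)\<close>, it says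
  \<open>g(\<tau>) / \<tau> = c F(x) / F(xc)\<close>, whose right-hand side tends to \<open>1\<close> as \<open>c \<rightarrow> 1\<close>. Hence \<open>g\<close>
  vanishes at \<open>0\<close> with derivative \<open>1\<close>, and after division by the powers of \<open>\<tau>\<close> the equation
  remains meaningful at \<open>c = 1\<close>.
\<close>

lemma scalar_flow_germ:
  fixes Ph Qh :: "real poly"
  assumes Dq: "\<And>a b. ev2 D a b \<noteq> 0 \<Longrightarrow> ev2 q a b \<noteq> 0"
    and eq: "\<And>a b c. \<lbrakk>c \<noteq> 0; ev2 D a b \<noteq> 0; ev2 D (a * c) (b * c) \<noteq> 0\<rbrakk> \<Longrightarrow>
      (1 - c) * quotient_at p q a b * poly Qh (quotient_at p q (a * c) (b * c) * ((1 - c) / c)) =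
        poly Ph (quotient_at p q (a * c) (b * c) * ((1 - c) / c))"
    and D: "D \<noteq> 0" and p: "p \<noteq> 0" and Qh: "Qh \<noteq> 0"
  obtains k P' Q' where "Ph = [:0, 1:] ^ Suc k * P'" "Qh = [:0, 1:] ^ k * Q'"
    "coeff Q' 0 \<noteq> 0" "coeff P' 0 = coeff Q' 0"
    "\<And>a b. \<lbrakk>ev2 D a b \<noteq> 0; ev2 p a b \<noteq> 0\<rbrakk> \<Longrightarrow> \<forall>\<^sub>F c in at 1.
      c * quotient_at p q a b * poly Q' (quotient_at p q (a * c) (b * c) * ((1 - c) / c)) =
      quotient_at p q (a * c) (b * c) * poly P' (quotient_at p q (a * c) (b * c) * ((1 - c) / c))"
proof -
  define F where "F = quotient_at p q"
  define \<tau> where "\<tau> a b c = F (a * c) (b * c) * ((1 - c) / c)" for a b c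
  obtain k Q' where Q: "Qh = [:0, 1:] ^ k * Q'" "coeff Q' 0 \<noteq> 0"
    using Qh by (rule split_off_X_power)
  have \<tau>_lim: "(\<tau> a b \<longlongrightarrow> 0) (at 1)" and F_lim: "((\<lambda>c. F (a * c) (b * c)) \<longlongrightarrow> F a b) (at 1)"
    if "ev2 D a b \<noteq> 0" for a b
  proof -
    show F: "((\<lambda>c. F (a * c) (b * c)) \<longlongrightarrow> F a b) (at 1)"
      unfolding F_def by (rule tendsto_quotient_at[OF Dq[OF that]])
    have "((\<lambda>c. F (a * c) (b * c) * ((1 - c) / c)) \<longlongrightarrow> F a b * ((1 - 1) / 1)) (at 1)"
      by (intro tendsto_intros F) simp
    then show "(\<tau> a b \<longlongrightarrow> 0) (at 1)" by (simp add: \<tau>_def[abs_def])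
  qed
  have near: "\<forall>\<^sub>F c in at 1. c \<noteq> 0 \<and> ev2 D (a * c) (b * c) \<noteq> 0 \<and> F (a * c) (b * c) \<noteq> 0 \<and>
      \<tau> a b c \<noteq> 0 \<and> (1 - c) = c * \<tau> a b c / F (a * c) (b * c)"
    if "ev2 D a b \<noteq> 0" "ev2 p a b \<noteq> 0" for a b
  proof -
    have "F a b \<noteq> 0" using that Dq by (simp add: F_def quotient_at_def)
    then have "\<forall>\<^sub>F c in at 1. F (a * c) (b * c) \<noteq> 0"
      by (rule tendsto_imp_eventually_ne[OF F_lim[OF that(1)]])
    moreover have "\<forall>\<^sub>F c in at (1::real). c \<noteq> 0"
      by (rule tendsto_imp_eventually_ne[OF tendsto_ident_at]) simp
    moreover have "\<forall>\<^sub>F c in at (1::real). c \<noteq> 1" by (rule eventually_neq_at_within)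
    ultimately show ?thesis using eventually_ev2_nonzero[OF that(1)]
      by eventually_elim (auto simp: \<tau>_def)
  qed
  have eq': "c * \<tau> a b c / F (a * c) (b * c) * F a b * poly Qh (\<tau> a b c) = poly Ph (\<tau> a b c)"
    if "ev2 D a b \<noteq> 0" "c \<noteq> 0" "ev2 D (a * c) (b * c) \<noteq> 0"
      "(1 - c) = c * \<tau> a b c / F (a * c) (b * c)" for a b c
    using eq[OF that(2,1,3)] unfolding F_def[symmetric] \<tau>_def[symmetric] that(4)[symmetric] .
  have "D * p \<noteq> 0" using D p by simp
  then obtain a b where "ev2 (D * p) a b \<noteq> 0" using ev2_zero_if_vanishes by blast
  then have ab: "ev2 D a b \<noteq> 0" "ev2 p a b \<noteq> 0" by auto
  have Fab: "F a b \<noteq> 0" using ab Dq by (simp add: F_def quotient_at_def)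
  have "((\<lambda>c. poly Q' (\<tau> a b c)) \<longlongrightarrow> poly Q' 0) (at 1)"
    by (intro tendsto_intros \<tau>_lim ab)
  then have "\<forall>\<^sub>F c in at 1. poly Q' (\<tau> a b c) \<noteq> 0"
    by (rule tendsto_imp_eventually_ne) (simp add: Q poly_0_coeff_0)
  with near[OF ab] have ev: "\<forall>\<^sub>F c in at 1. c * F a b / F (a * c) (b * c) =
      poly Ph (\<tau> a b c) / (\<tau> a b c * poly Qh (\<tau> a b c))"
  proof eventually_elim
    case (elim c)
    have "poly Qh (\<tau> a b c) \<noteq> 0" using elim by (simp add: Q)
    then show ?case using eq'[OF ab(1), of c, symmetric] elim by simp
  qed
  have "((\<lambda>c. c * F a b / F (a * c) (b * c)) \<longlongrightarrow> 1 * F a b / F a b) (at 1)"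
    by (intro tendsto_intros F_lim ab Fab)
  then have "((\<lambda>c. poly Ph (\<tau> a b c) / (\<tau> a b c * poly Qh (\<tau> a b c))) \<longlongrightarrow> 1) (at 1)"
    using Lim_transform_eventually[OF _ ev] Fab by simp
  moreover have "\<forall>\<^sub>F c in at 1. \<tau> a b c \<noteq> 0" using near[OF ab] by eventually_elim simp
  ultimately obtain P' where P: "Ph = [:0, 1:] ^ Suc k * P'" "coeff P' 0 = coeff Q' 0"
    using limit_one_imp_orders[OF Q \<tau>_lim[OF ab(1)]] by blast
  have "\<forall>\<^sub>F c in at 1. c * F a b * poly Q' (\<tau> a b c) = F (a * c) (b * c) * poly P' (\<tau> a b c)"
    if D: "ev2 D a b \<noteq> 0" "ev2 p a b \<noteq> 0" for a b
    using near[OF D]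
  proof eventually_elim
    case (elim c)
    have "\<tau> a b c ^ Suc k * (c * F a b * poly Q' (\<tau> a b c)) =
        \<tau> a b c ^ Suc k * (F (a * c) (b * c) * poly P' (\<tau> a b c))"
      using eq'[OF D(1), of c] elim by (simp add: P Q field_simps)
    then show ?case using elim by simp
  qed
  then show thesis using that[OF P(1) Q(1) Q(2) P(2)] by (simp add: F_def \<tau>_def)
qed

text \<open>
  Differentiating the desingularised equation at \<open>c = 1\<close> replaces it by a Riccati equation: only
  the second order coefficient of \<open>g\<close> at \<open>0\<close> enters.
\<close>

lemma derivative_of_scalar_flow:
  assumes f: "(f has_real_derivative f') (at 1)" and
    ev: "\<forall>\<^sub>F c in at 1. c * f 1 * poly Q' (f c * ((1 - c) / c)) = f c * poly P' (f c * ((1 - c) / c))"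
    and "coeff P' 0 = coeff Q' 0"
  shows "coeff Q' 0 * f' = coeff Q' 0 * f 1 + (coeff P' 1 - coeff Q' 1) * f 1 ^ 2"
proof -
  define \<tau> where "\<tau> c = f c * ((1 - c) / c)" for c
  have \<tau>: "(\<tau> has_real_derivative - f 1) (at 1)" "\<tau> 1 = 0"
    unfolding \<tau>_def by (rule derivative_eq_intros f refl | simp)+
  have R: "((\<lambda>c. poly R (\<tau> c)) has_real_derivative coeff R 1 * - f 1) (at 1)" for R
  proof -
    have "poly (pderiv R) (\<tau> 1) = coeff R 1"
      by (simp add: \<tau>(2) poly_0_coeff_0 coeff_pderiv)
    then show ?thesis using DERIV_chain2[OF poly_DERIV \<tau>(1), of R] by simp
  qed
  have 1: "((\<lambda>c. c * f 1 * poly Q' (\<tau> c)) has_real_derivative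
      f 1 * coeff Q' 0 + f 1 * (coeff Q' 1 * - f 1)) (at 1)"
    by (rule derivative_eq_intros R refl)+ (simp add: \<tau>(2) poly_0_coeff_0)
  have 2: "((\<lambda>c. f c * poly P' (\<tau> c)) has_real_derivative
      f' * coeff P' 0 + f 1 * (coeff P' 1 * - f 1)) (at 1)"
    by (rule derivative_eq_intros R f refl)+ (simp add: \<tau>(2) poly_0_coeff_0)
  have "\<forall>\<^sub>F c in nhds 1. c * f 1 * poly Q' (\<tau> c) = f c * poly P' (\<tau> c)"
    using ev unfolding \<tau>_def[symmetric] eventually_at_filter
    by eventually_elim (use assms(3) in \<open>auto simp: \<tau>(2) poly_0_coeff_0\<close>)
  from DERIV_cong_ev[OF refl this refl, THEN iffD2, OF 2]
  have "((\<lambda>c. c * f 1 * poly Q' (\<tau> c)) has_real_derivative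
      f' * coeff P' 0 + f 1 * (coeff P' 1 * - f 1)) (at 1)" .
  from DERIV_unique[OF this 1] show ?thesis
    using assms(3) by (simp add: algebra_simps power2_eq_square)
qed

section \<open>Solving the equation with proportional components\<close>

text \<open>
  Applied at the generic points of a ray, the derivative at \<open>c = 1\<close> yields the Euler equation
  \<open>t F'(t) = F(t) - C F(t)\<^sup>2\<close> for the restriction of \<open>p / q\<close>, with the same \<open>C\<close> on every ray.
  It says that \<open>t (1 / F(t) - C)\<close> is constant, i.e. that \<open>p / (q - C p)\<close> is homogeneous of degree
  one. The conclusion states this with denominators cleared.
\<close>

lemma scalar_flow_homogeneity:
  fixes Ph Qh :: "real poly"
  assumes Dq: "\<And>a b. ev2 D a b \<noteq> 0 \<Longrightarrow> ev2 q a b \<noteq> 0"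
    and eq: "\<And>a b c. \<lbrakk>c \<noteq> 0; ev2 D a b \<noteq> 0; ev2 D (a * c) (b * c) \<noteq> 0\<rbrakk> \<Longrightarrow>
      (1 - c) * quotient_at p q a b * poly Qh (quotient_at p q (a * c) (b * c) * ((1 - c) / c)) =
        poly Ph (quotient_at p q (a * c) (b * c) * ((1 - c) / c))"
    and D: "D \<noteq> 0" and p: "p \<noteq> 0" and Qh: "Qh \<noteq> 0"
  obtains k P' Q' C where "Ph = [:0, 1:] ^ Suc k * P'" "Qh = [:0, 1:] ^ k * Q'"
    "coeff Q' 0 \<noteq> 0" "coeff P' 0 = coeff Q' 0"
    "[:0, 1:] * dilate (q - [:[:C:]:] * p) * [:p:] = [:q - [:[:C:]:] * p:] * dilate p"
proof -
  obtain k P' Q' where P: "Ph = [:0, 1:] ^ Suc k * P'" and Q: "Qh = [:0, 1:] ^ k * Q'"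
    "coeff Q' 0 \<noteq> 0" and PQ: "coeff P' 0 = coeff Q' 0" and
    flow: "\<And>a b. \<lbrakk>ev2 D a b \<noteq> 0; ev2 p a b \<noteq> 0\<rbrakk> \<Longrightarrow> \<forall>\<^sub>F c in at 1.
      c * quotient_at p q a b * poly Q' (quotient_at p q (a * c) (b * c) * ((1 - c) / c)) =
      quotient_at p q (a * c) (b * c) * poly P' (quotient_at p q (a * c) (b * c) * ((1 - c) / c))"
    using scalar_flow_germ[of D q p Qh Ph, OF Dq eq D p Qh] by blast
  define C where "C = (coeff Q' 1 - coeff P' 1) / coeff Q' 0"
  define n where "n = q - [:[:C:]:] * p"
  have ev_n: "ev2 n a b = ev2 q a b - C * ev2 p a b" for a b
    unfolding n_def ev2_simps by (simp add: ev2_pCons)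
  have euler1: "poly (pderiv (ray p a b)) 1 * ev2 q a b - ev2 p a b * poly (pderiv (ray q a b)) 1 =
      ev2 p a b * ev2 q a b - C * ev2 p a b ^ 2"
    if D: "ev2 D a b \<noteq> 0" "ev2 p a b \<noteq> 0" for a b
  proof -
    define f where "f c = poly (ray p a b) c / poly (ray q a b) c" for c
    have f: "f c = quotient_at p q (a * c) (b * c)" for c
      by (simp add: f_def poly_ray quotient_at_def)
    let ?f' = "(poly (pderiv (ray p a b)) 1 * ev2 q a b - ev2 p a b * poly (pderiv (ray q a b)) 1) /
        ev2 q a b ^ 2"
    have q: "ev2 q a b \<noteq> 0" using Dq[OF D(1)] .
    have "(f has_real_derivative ?f') (at 1)"
      unfolding f_def
      using DERIV_divide[OF poly_DERIV poly_DERIV, of "ray q a b" 1 "ray p a b"] q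
      by (simp add: poly_ray power2_eq_square)
    moreover have "\<forall>\<^sub>F c in at 1. c * f 1 * poly Q' (f c * ((1 - c) / c)) =
        f c * poly P' (f c * ((1 - c) / c))"
      using flow[OF D] by (simp add: f)
    ultimately have "coeff Q' 0 * ?f' = coeff Q' 0 * f 1 + (coeff P' 1 - coeff Q' 1) * f 1 ^ 2"
      by (rule derivative_of_scalar_flow[OF _ _ PQ])
    also have "coeff P' 1 - coeff Q' 1 = coeff Q' 0 * - C" using Q(2) by (simp add: C_def)
    also have "coeff Q' 0 * f 1 + coeff Q' 0 * - C * f 1 ^ 2 = coeff Q' 0 * (f 1 - C * f 1 ^ 2)"
      by (simp add: algebra_simps)
    finally have "?f' = f 1 - C * f 1 ^ 2" using Q(2) by (simp only: mult_cancel_left) simp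
    then have "?f' * ev2 q a b ^ 2 = (f 1 - C * f 1 ^ 2) * ev2 q a b ^ 2" by simp
    also have "f 1 = ev2 p a b / ev2 q a b" by (simp add: f quotient_at_def)
    finally show ?thesis using q by (simp add: field_simps power2_eq_square)
  qed
  \<comment> \<open>On a fixed ray the Euler equation becomes a linear equation for \<open>W = t n\<close>.\<close>
  have "t * ev2 n (a * t) (b * t) * ev2 p a b = ev2 n a b * ev2 p (a * t) (b * t)"
    if D: "ev2 D a b \<noteq> 0" "ev2 p a b \<noteq> 0" for a b t
  proof -
    define P1 Q1 W where "P1 = ray p a b" and "Q1 = ray q a b" and "W = [:0, 1:] * (Q1 - smult C P1)"
    have nz: "P1 \<noteq> 0" "ray D a b \<noteq> 0"
      using D poly_ray[of p a b 1] poly_ray[of D a b 1] by (auto simp: P1_def)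
    define E where "E = [:0, 1:] * (pderiv P1 * Q1 - P1 * pderiv Q1) - (P1 * Q1 - smult C (P1 ^ 2))"
    have E: "poly E t = 0" if t: "poly (ray D a b) t \<noteq> 0" "poly P1 t \<noteq> 0" for t
    proof -
      have "pderiv (ray r (a * t) (b * t)) = smult t (pcompose (pderiv (ray r a b)) [:0, t:])" for r
        unfolding ray_scaled pderiv_pcompose by (simp add: pderiv_pCons)
      then have "poly (pderiv (ray r (a * t) (b * t))) 1 = t * poly (pderiv (ray r a b)) t" for r
        by (simp add: poly_pcompose)
      then show ?thesis
        using euler1[of "a * t" "b * t"] t
        by (simp add: E_def P1_def Q1_def poly_ray[symmetric] algebra_simps)
    qed
    have "ray D a b * P1 * E = 0"
      by (rule poly_eqI_eval) (use E in auto)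
    then have "E = 0" using nz by simp
    then have E': "[:0, 1:] * (pderiv P1 * Q1 - P1 * pderiv Q1) = P1 * Q1 - smult C (P1 ^ 2)"
      by (simp add: E_def)
    have "pderiv W * P1 - W * pderiv P1 =
        (P1 * Q1 - smult C (P1 ^ 2)) - [:0, 1:] * (pderiv P1 * Q1 - P1 * pderiv Q1)"
      by (rule poly_eqI_eval)
        (simp add: W_def pderiv_mult pderiv_diff pderiv_smult pderiv_pCons algebra_simps power2_eq_square)
    then have "pderiv W * P1 = W * pderiv P1" unfolding E' by simp
    then obtain \<kappa> where \<kappa>: "W = smult \<kappa> P1" using pderiv_proportional nz(1) by blast
    have "t * ev2 n (a * t) (b * t) = \<kappa> * ev2 p (a * t) (b * t)" for t
      using arg_cong[OF \<kappa>, of "\<lambda>p. poly p t"]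
      by (simp add: W_def P1_def Q1_def poly_ray ev_n)
    from this[of t] this[of 1] show ?thesis by simp
  qed
  then have "[:0, 1:] * dilate n * [:p:] - [:n:] * dilate p = 0"
    using D p by (intro ev3_generic_zero[of "[:D * p:]"])
      (simp_all only: ev3_simps ev3_dilate ev3_const, auto simp: ev3_pCons)
  then show thesis using that[OF P Q PQ, of C] by (simp add: n_def)
qed

text \<open>
  The function \<open>R = f / (1 - C f)\<close> is homogeneous of degree one and \<open>f = R / (C R + 1)\<close>. For
  \<open>R(A, B) = 1\<close>, restrict to the line through \<open>(A, B)\<close>: homogeneity makes \<open>R(At, Bt)\<close> equal to \<open>r t\<close> with
  \<open>r = R(A, B)\<close>, and \<open>r = 1\<close> because \<open>f(At, Bt)\<close> has derivative \<open>1\<close> at \<open>t = 0\<close>. That the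
  reduced denominator of \<open>R\<close> does not vanish at \<open>(A, B)\<close> follows from coprimality: the zero set of this
  denominator is invariant under scaling, and the whole line cannot lie in it.
\<close>

lemma linear_fractional_solution:
  assumes f: "quot_of_fract f = (p, q)" "f \<noteq> 0"
    and Dq: "\<And>a b. ev2 D a b \<noteq> 0 \<Longrightarrow> ev2 q a b \<noteq> 0"
    and eq: "\<And>a b c. \<lbrakk>c \<noteq> 0; ev2 D a b \<noteq> 0; ev2 D (a * c) (b * c) \<noteq> 0\<rbrakk> \<Longrightarrow>
      (1 - c) * quotient_at p q a b * poly (ray q A B) (quotient_at p q (a * c) (b * c) * ((1 - c) / c)) =
        poly (ray p A B) (quotient_at p q (a * c) (b * c) * ((1 - c) / c))"
    and D: "D \<noteq> 0" and line: "ray q A B \<noteq> 0"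
  shows "\<exists>R C. one_homogeneous R \<and> ratfun_defined_at (\<lambda>t. t) R A B \<and> ratfun_eval (\<lambda>t. t) R A B = 1 \<and>
    const2 C * R + 1 \<noteq> 0 \<and> f = R / (const2 C * R + 1)"
proof -
  have p: "p \<noteq> 0" using f by (metis fst_conv fst_quot_of_fract_eq_0_iff)
  have q: "q \<noteq> 0" using f by (metis snd_conv snd_quot_of_fract_nonzero)
  have f_eq: "f = Fract p q" using f by (metis Fract_quot_of_fract fst_conv snd_conv)
  obtain k P' Q' C where lines: "ray p A B = [:0, 1:] ^ Suc k * P'" "ray q A B = [:0, 1:] ^ k * Q'"
    "coeff Q' 0 \<noteq> 0" "coeff P' 0 = coeff Q' 0"
    and hom: "[:0, 1:] * dilate (q - [:[:C:]:] * p) * [:p:] = [:q - [:[:C:]:] * p:] * dilate p"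
    using scalar_flow_homogeneity[of D q p "ray q A B" "ray p A B", OF Dq eq D p line] by blast
  define n where "n = q - [:[:C:]:] * p"
  note hom = hom[folded n_def]
  have ev_n: "ev2 n a b = ev2 q a b - C * ev2 p a b" for a b
    unfolding n_def ev2_simps by (simp add: ev2_pCons)
  define M where "M = Q' - smult C ([:0, 1:] * P')"
  have ray_n: "ray n A B = [:0, 1:] ^ k * M"
  proof (rule poly_eqI_eval)
    fix t
    have "poly (ray n A B) t = poly (ray q A B) t - C * poly (ray p A B) t"
      by (simp add: poly_ray ev_n)
    also have "\<dots> = poly ([:0, 1:] ^ k * M) t" by (simp add: lines M_def algebra_simps)
    finally show "poly (ray n A B) t = poly ([:0, 1:] ^ k * M) t" .
  qed
  have M0: "coeff M 0 = coeff Q' 0" by (simp add: M_def)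
  then have ray_n_nz: "ray n A B \<noteq> 0" using lines(3) by (auto simp: ray_n)
  then have n: "n \<noteq> 0" by (auto simp: ray_def rhomD(1)[OF rhom_dilate])
  define R where "R = Fract p n"
  obtain P Q where PQ: "quot_of_fract R = (P, Q)" by fastforce
  have Q: "Q \<noteq> 0" using PQ by (metis snd_conv snd_quot_of_fract_nonzero)
  have "Fract P Q = Fract p n" using PQ R_def by (metis Fract_quot_of_fract fst_conv snd_conv)
  then have cross: "P * n = p * Q" using Q n by (simp add: eq_fract)
  have cop: "coprime P Q" using PQ by (metis coprime_quot_of_fract fst_conv snd_conv)
  have "Q dvd P * n" unfolding cross by simp
  then have "Q dvd n" using cop by (simp add: coprime_dvd_mult_right_iff coprime_commute)
  then obtain m where m: "n = Q * m" by blast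
  have "P * m * Q = p * Q" using cross by (simp add: m mult_ac)
  then have m': "p = P * m" using Q by simp
  have m_nz: "m \<noteq> 0" "dilate m \<noteq> 0" using m n by (auto simp: dilate_eq_0_iff)
  note dil = rhomD(4)[OF rhom_dilate]
  have const_mult: "[:x * y:] = [:x:] * [:y:]" for x y :: "real poly poly" by simp
  have "([:0, 1:] * dilate Q * [:P:]) * (dilate m * [:m:]) = ([:Q:] * dilate P) * (dilate m * [:m:])"
    using hom unfolding m m' dil const_mult by (simp only: mult_ac)
  then have homR: "[:0, 1:] * dilate Q * [:P:] = [:Q:] * dilate P"
    using m_nz by (simp only: mult_cancel_right) simp
  then have "one_homogeneous R"
    by (intro one_homogeneousI[OF PQ]) (simp only: mult_ac)
  have homR_ev: "t * ev2 Q (a * t) (b * t) * ev2 P a b = ev2 Q a b * ev2 P (a * t) (b * t)" for a b t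
    using arg_cong[OF homR, of "\<lambda>p. ev3 p a b t"]
    unfolding ev3_simps ev3_dilate ev3_const by (simp add: ev3_pCons)
  have QAB: "ev2 Q A B \<noteq> 0"
  proof
    assume 0: "ev2 Q A B = 0"
    have "[:0, 1:] * ray n A B \<noteq> 0" using ray_n_nz by simp
    then obtain t where "poly ([:0, 1:] * ray n A B) t \<noteq> 0"
      using poly_zero_if_vanishes by blast
    then have t: "t \<noteq> 0" "ev2 n (A * t) (B * t) \<noteq> 0" by (auto simp: poly_ray)
    \<comment> \<open>At a fixed real \<open>t\<close>, coprimality turns homogeneity into divisibility of \<open>Q(xt, yt)\<close> by \<open>Q\<close>.\<close>
    define scale where "scale r = poly (dilate r) [:[:t:]:]" for r
    have ev_scale: "ev2 (scale r) a b = ev2 r (a * t) (b * t)" for r a b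
    proof -
      have "ev2 (poly g [:[:t:]:]) a b = ev3 g a b t" for g
        by (induction g) (simp_all add: ev3_pCons ev2_pCons ev2_smult)
      then show ?thesis by (simp add: scale_def ev3_dilate)
    qed
    have "[:[:t:]:] * scale Q * P - Q * scale P = 0"
    proof (rule ev2_zero_if_vanishes)
      fix a b
      show "ev2 ([:[:t:]:] * scale Q * P - Q * scale P) a b = 0"
        unfolding ev2_simps ev_scale using homR_ev[of t a b] by (simp add: ev2_pCons)
    qed
    then have "Q dvd [:[:t:]:] * scale Q * P" by simp
    then have "Q dvd [:[:t:]:] * scale Q"
      using cop by (simp only: coprime_dvd_mult_left_iff coprime_commute)
    then obtain g where "[:[:t:]:] * scale Q = Q * g" by blast
    then have "ev2 ([:[:t:]:] * scale Q) A B = ev2 (Q * g) A B" by simp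
    then have "t * ev2 Q (A * t) (B * t) = 0"
      unfolding ev2_simps ev_scale using 0 by (simp add: ev2_pCons)
    then show False using t by (simp add: m)
  qed
  define r where "r = ev2 P A B / ev2 Q A B"
  have "ray p A B = smult r ([:0, 1:] * ray n A B)"
  proof (rule poly_eqI_eval)
    fix t
    have "ev2 P (A * t) (B * t) = r * t * ev2 Q (A * t) (B * t)"
      using homR_ev[of t A B] QAB by (simp add: r_def field_simps)
    then show "poly (ray p A B) t = poly (smult r ([:0, 1:] * ray n A B)) t"
      by (simp add: poly_ray m m')
  qed
  then have "[:0, 1:] ^ Suc k * P' = [:0, 1:] ^ Suc k * smult r M"
    unfolding lines ray_n by (simp add: mult_ac)
  then have "P' = smult r M" by (subst (asm) mult_cancel_left) simp
  then have "r = 1" using lines(3,4) M0 by simp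
  have "const2 C = Fract [:[:C:]:] 1" by (simp add: const2_def)
  then have den: "const2 C * R + 1 = Fract q n"
    using n by (simp add: R_def One_fract_def n_def)
  have "one_homogeneous R" by fact
  moreover have "ratfun_defined_at (\<lambda>t. t) R A B"
    using QAB by (simp add: ratfun_defined_at_def poly2_eq_subst2 PQ)
  moreover have "ratfun_eval (\<lambda>t. t) R A B = 1"
    using \<open>r = 1\<close> by (simp add: ratfun_eval_def poly2_eq_subst2 PQ r_def)
  moreover have "const2 C * R + 1 \<noteq> 0"
    unfolding den using n q by (simp add: Zero_fract_def eq_fract)
  moreover have "f = R / (const2 C * R + 1)"
    unfolding den unfolding f_eq R_def using n q by (simp add: eq_fract)
  ultimately show ?thesis by blast
qed

section \<open>The classification\<close>

lemma translation_equation_proportional: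
  assumes eq: "translation_equation (u, v)" and lim: "\<not> limit_condition (u, v)"
    and u: "quot_of_fract u = (p1, q1)" and v: "quot_of_fract v = (p2, q2)"
  shows "p1 = 0 \<or> (\<exists>r. p2 * q1 = [:[:r:]:] * (p1 * q2))"
proof -
  have q: "q1 \<noteq> 0" "q2 \<noteq> 0" using u v by (metis snd_conv snd_quot_of_fract_nonzero)+
  let ?D = "q1 * q2" and ?F1 = "quotient_at p1 q1" and ?F2 = "quotient_at p2 q2"
  have Y: "((\<lambda>c. ?F1 (a * c) (b * c)) \<longlongrightarrow> ?F1 a b) (at 1)" "((\<lambda>c. ?F2 (a * c) (b * c)) \<longlongrightarrow> ?F2 a b) (at 1)"
    if "ev2 ?D a b \<noteq> 0" for a b
    using that by (auto intro!: tendsto_quotient_at)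
  note real = translation_equation_real[OF eq u v refl, folded quotient_at_def]
  have x: "homogeneous 1 [:[:0, 1:]:]" and y: "homogeneous 1 [:0, 1:]"
    by (simp_all add: homogeneous_def ev2_pCons)
  let ?H = "\<lambda>k H. homogeneous k H \<and> H \<noteq> 0 \<and> (\<forall>a b. ev2 ?D a b \<noteq> 0 \<longrightarrow> ev2 H (?F1 a b) (?F2 a b) = 0)"
  have dich1: "(\<exists>k H. ?H k H) \<or> (\<exists>d. d \<noteq> 0 \<and> (\<forall>a b. ev2 d a b \<noteq> 0 \<longrightarrow>
      ((\<lambda>z. ev2 p1 (a * z) (b * z) / ev2 q1 (a * z) (b * z) / z) \<longlongrightarrow> ev2 [:[:0, 1:]:] a b) (at 0)))"
    by (rule component_dichotomy[of q1 _ ?D ?F1 ?F2, OF q(1) x Y])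
      (use real(1) in \<open>simp_all add: ev2_pCons\<close>)
  have dich2: "(\<exists>k H. ?H k H) \<or> (\<exists>d. d \<noteq> 0 \<and> (\<forall>a b. ev2 d a b \<noteq> 0 \<longrightarrow>
      ((\<lambda>z. ev2 p2 (a * z) (b * z) / ev2 q2 (a * z) (b * z) / z) \<longlongrightarrow> ev2 [:0, 1:] a b) (at 0)))"
    by (rule component_dichotomy[of q2 _ ?D ?F1 ?F2, OF q(2) y Y])
      (use real(2) in \<open>simp_all add: ev2_pCons\<close>)
  have "\<exists>k H. ?H k H"
  proof (rule ccontr)
    assume no: "\<nexists>k H. ?H k H"
    obtain d1 where d1: "d1 \<noteq> 0" "\<And>a b. ev2 d1 a b \<noteq> 0 \<Longrightarrow>
      ((\<lambda>z. ev2 p1 (a * z) (b * z) / ev2 q1 (a * z) (b * z) / z) \<longlongrightarrow> ev2 [:[:0, 1:]:] a b) (at 0)"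
      using dich1 no by blast
    obtain d2 where d2: "d2 \<noteq> 0" "\<And>a b. ev2 d2 a b \<noteq> 0 \<Longrightarrow>
      ((\<lambda>z. ev2 p2 (a * z) (b * z) / ev2 q2 (a * z) (b * z) / z) \<longlongrightarrow> ev2 [:0, 1:] a b) (at 0)"
      using dich2 no by blast
    have "((\<lambda>z. scale_pair (1 / z) (pair_eval (\<lambda>t. t) (u, v) (a * z, b * z))) \<longlongrightarrow> (a, b)) (at 0)"
      if "ev2 (d1 * d2) a b \<noteq> 0" for a b
    proof -
      have "((\<lambda>z. (ev2 p1 (a * z) (b * z) / ev2 q1 (a * z) (b * z) / z,
          ev2 p2 (a * z) (b * z) / ev2 q2 (a * z) (b * z) / z)) \<longlongrightarrow> (a, b)) (at 0)"
        using tendsto_Pair[OF d1(2)[of a b] d2(2)[of a b]] that by (simp add: ev2_pCons)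
      then show ?thesis
        by (simp add: scale_pair_def pair_eval_def ratfun_eval_def u v poly2_eq_subst2 mult.commute)
    qed
    then have "limit_condition (u, v)"
      unfolding limit_condition_def poly2_eq_subst2 using d1(1) d2(1)
      by (intro exI[of _ "d1 * d2"]) simp
    with lim show False ..
  qed
  then obtain k H where "homogeneous k H" "H \<noteq> 0"
    "\<And>a b. ev2 ?D a b \<noteq> 0 \<Longrightarrow> ev2 H (?F1 a b) (?F2 a b) = 0" by blast
  then show ?thesis
    unfolding quotient_at_def using q by (intro homogeneous_relation_imp_proportional) auto
qed

text \<open>
  The common factor \<open>f\<close> can be chosen to be one of the two components, so its reduced
  representation is one of theirs and is regular wherever theirs are.
\<close>

lemma translation_equation_line:
  assumes eq: "translation_equation (u, v)" and lim: "\<not> limit_condition (u, v)"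
    and nz: "(u, v) \<noteq> (0, 0)"
  obtains f A B where "u = const2 A * f" "v = const2 B * f" "f \<noteq> 0" "A = 1 \<and> f = u \<or> B = 1 \<and> f = v"
proof -
  obtain p1 q1 where u: "quot_of_fract u = (p1, q1)" by fastforce
  obtain p2 q2 where v: "quot_of_fract v = (p2, q2)" by fastforce
  have q: "q1 \<noteq> 0" "q2 \<noteq> 0" using u v by (metis snd_conv snd_quot_of_fract_nonzero)+
  have uv: "u = Fract p1 q1" "v = Fract p2 q2"
    using u v by (metis Fract_quot_of_fract fst_conv snd_conv)+
  have c: "const2 0 = 0" "const2 1 = 1"
    by (simp_all add: const2_def Zero_fract_def One_fract_def one_pCons)
  consider "u = 0" | r where "u \<noteq> 0" "p2 * q1 = [:[:r:]:] * (p1 * q2)"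
    using translation_equation_proportional[OF eq lim u v] by (auto simp: uv fract_collapse)
  then show thesis
  proof cases
    case 1
    then show ?thesis using that[of 0 v 1] nz by (simp add: c)
  next
    case 2
    then have "v = const2 r * u"
      using q by (simp add: uv const2_def eq_fract mult_ac)
    then show ?thesis using that[of 1 u r] 2 by (simp add: c)
  qed
qed

theorem proposition6:
  fixes \<phi> :: "ratfun2 \<times> ratfun2"
  assumes "translation_equation \<phi>"
    and "\<not> limit_condition \<phi>"
  shows "\<phi> = (0, 0) \<or>
    (\<exists>(R :: ratfun2) (A :: real) (B :: real) (c :: real).
       one_homogeneous R \<and>
       ratfun_defined_at (\<lambda>t. t) R A B \<and> ratfun_eval (\<lambda>t. t) R A B = 1 \<and>
       const2 c * R + 1 \<noteq> 0 \<and>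
       \<phi> = (const2 A * (R / (const2 c * R + 1)), const2 B * (R / (const2 c * R + 1))))"
proof (cases "\<phi> = (0, 0)")
  case False
  obtain u v where \<phi>: "\<phi> = (u, v)" by fastforce
  note eq = assms(1)[unfolded \<phi>]
  obtain f A B where f: "u = const2 A * f" "v = const2 B * f" "f \<noteq> 0"
    "A = 1 \<and> f = u \<or> B = 1 \<and> f = v"
    using translation_equation_line[OF eq] assms(2) False \<phi> by blast
  obtain p1 q1 where u: "quot_of_fract u = (p1, q1)" by fastforce
  obtain p2 q2 where v: "quot_of_fract v = (p2, q2)" by fastforce
  obtain p q where pq: "quot_of_fract f = (p, q)" by fastforce
  have nz: "q1 \<noteq> 0" "q2 \<noteq> 0" "q \<noteq> 0" using u v pq by (metis snd_conv snd_quot_of_fract_nonzero)+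
  have fracts: "u = Fract p1 q1" "v = Fract p2 q2" "f = Fract p q"
    using u v pq by (metis Fract_quot_of_fract fst_conv snd_conv)+
  have cross: "p1 * q = [:[:A:]:] * p * q1" "p2 * q = [:[:B:]:] * p * q2"
    using f(1,2) nz unfolding fracts by (simp_all add: const2_def eq_fract)
  define D where "D = q1 * q2"
  have D: "D \<noteq> 0" using nz by (simp add: D_def)
  have which: "p = p1 \<and> q = q1 \<and> A = 1 \<or> p = p2 \<and> q = q2 \<and> B = 1"
    using f(4) u v pq by auto
  have Dq: "ev2 q a b \<noteq> 0" if "ev2 D a b \<noteq> 0" for a b
    using that which by (auto simp: D_def)
  have coords: "ev2 p1 a b / ev2 q1 a b = A * quotient_at p q a b"
    "ev2 p2 a b / ev2 q2 a b = B * quotient_at p q a b" if "ev2 D a b \<noteq> 0" for a b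
  proof -
    have "ev2 p1 a b * ev2 q a b = A * ev2 p a b * ev2 q1 a b"
      "ev2 p2 a b * ev2 q a b = B * ev2 p a b * ev2 q2 a b"
      using arg_cong[OF cross(1), of "\<lambda>r. ev2 r a b"] arg_cong[OF cross(2), of "\<lambda>r. ev2 r a b"]
      unfolding ev2_simps by (simp_all add: ev2_pCons)
    then show "ev2 p1 a b / ev2 q1 a b = A * quotient_at p q a b"
      "ev2 p2 a b / ev2 q2 a b = B * quotient_at p q a b"
      using that Dq[OF that] by (auto simp: quotient_at_def D_def field_simps)
  qed
  note real = translation_equation_real[OF eq u v D_def]
  have line_eq: "(1 - c) * quotient_at p q a b * poly (ray q A B) (quotient_at p q (a * c) (b * c) * ((1 - c) / c)) =
      poly (ray p A B) (quotient_at p q (a * c) (b * c) * ((1 - c) / c))"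
    if "c \<noteq> 0" "ev2 D a b \<noteq> 0" "ev2 D (a * c) (b * c) \<noteq> 0" for a b c
    using which real(1,2)[OF that] coords[OF that(2)] coords[OF that(3)]
    by (auto simp: poly_ray mult.assoc)
  have "ray q A B \<noteq> 0"
  proof -
    obtain a b c where D: "ev2 D (a * c) (b * c) \<noteq> 0" and
      "ev2 q (ev2 p1 (a * c) (b * c) / ev2 q1 (a * c) (b * c) * ((1 - c) / c))
        (ev2 p2 (a * c) (b * c) / ev2 q2 (a * c) (b * c) * ((1 - c) / c)) \<noteq> 0"
      using real(3) which by blast
    then have "poly (ray q A B) (quotient_at p q (a * c) (b * c) * ((1 - c) / c)) \<noteq> 0"
      unfolding coords[OF D] by (simp add: poly_ray mult.assoc)
    then show ?thesis by auto
  qed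
  from linear_fractional_solution[of f p q D A B, OF pq f(3) Dq line_eq D this]
  obtain R c where R: "one_homogeneous R" "ratfun_defined_at (\<lambda>t. t) R A B"
    "ratfun_eval (\<lambda>t. t) R A B = 1" "const2 c * R + 1 \<noteq> 0" "f = R / (const2 c * R + 1)"
    by blast
  have "\<phi> = (const2 A * (R / (const2 c * R + 1)), const2 B * (R / (const2 c * R + 1)))"
    unfolding R(5)[symmetric] \<phi> f(1,2)[symmetric] ..
  with R(1-4) show ?thesis by blast
qed simp

end
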